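(* Let $u\in C^3(\mathbb R^2)$ satisfy $\inf_{\mathbb R^2}|\nabla u|>0$. Then there exists $\Phi\in C^1(\mathbb R^2;\mathbb R^2)$ whose Jacobian matrix $\nabla\Phi(x)$ is invertible for every $x\in\mathbb R^2$ and such that $\nabla\Phi\,\nabla u=e_1=(1,0)^T$ in $\mathbb R^2$. *)

theory Defs
  imports "HOL-Analysis.Analysis"
begin

definition partial_deriv :: "'n::finite \<Rightarrow> (real^'n \<Rightarrow> real) \<Rightarrow> real^'n \<Rightarrow> real" where
  "partial_deriv i f x = frechet_derivative f (at x) (axis i 1)"

definition grad :: "(real^'n::finite \<Rightarrow> real) \<Rightarrow> real^'n \<Rightarrow> real^'n" where
  "grad f x = (\<chi> i. partial_deriv i f x)"

fun Ck :: "nat \<Rightarrow> (real^'n::finite \<Rightarrow> real) \<Rightarrow> bool" where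
  "Ck 0 f = continuous_on UNIV f"
| "Ck (Suc k) f = ((\<forall>x. f differentiable (at x)) \<and> (\<forall>i. Ck k (partial_deriv i f)))"

definition jacobian :: "(real^'n::finite \<Rightarrow> real^'m::finite) \<Rightarrow> real^'n \<Rightarrow> real^'n^'m" where
  "jacobian F x = matrix (frechet_derivative F (at x))"

end

(*
  Both components of Phi come from the transport equation  grad w . grad u = h.  It is solvable with
  w in C^1 for every h in C^1: the field Y = grad u / |grad u|^2 is C^2 and, thanks to the lower bound
  on |grad u|, bounded, so it has a global C^1 flow, along which u grows at unit speed; integrate
  h / |grad u|^2 along the trajectory from the level set u = 0 to x.

  Take Phi_1 with h = 1, and w with h = - Laplace u.  Then m = exp w satisfies div (m grad u) = 0, hence
  (- m u_y, m u_x) is closed, and Phi_2 is a potential of it.  So grad Phi_2 . grad u = 0, and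
  det (D Phi) = m (grad Phi_1 . grad u) = m > 0.
*)
theory Submission
  imports Defs
begin

section \<open>Calculus of partial derivatives\<close>

text \<open>Straightening grad u by flow coordinates would call for a differentiable inverse of the
  flow; taking the second component as a potential avoids this and makes the determinant explicit.
  The rotated gradient of u is closed only if u is harmonic, hence the integrating factor m. Since
  div (m grad u) = grad m . grad u + m Laplace u, the ansatz m = exp w turns the condition on m into
  a transport equation for w and keeps m positive. The three derivatives of u are spent twice:
  Laplace u has to be C^1 to serve as a right-hand side, and Y has to be C^2 so that its derivative
  is locally Lipschitz. The latter makes the derivatives of the Picard iterates converge along with
  the iterates, so the construction itself delivers a C^1 flow. In place of the group law of the
  flow stands its infinitesimal form: the space derivative of the flow carries Y at x to Y at the
  image point. This is what makes the derivative of w along Y computable.\<close>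

lemma continuous_bounded_on_cball:
  fixes f :: "'a::euclidean_space \<Rightarrow> 'b::real_normed_vector"
  assumes "continuous_on UNIV f"
  obtains L where "0 \<le> L" "\<And>x. norm x \<le> R \<Longrightarrow> norm (f x) \<le> L"
proof -
  have "compact (f ` cball 0 R)"
    by (intro compact_continuous_image continuous_on_subset[OF assms]) auto
  then obtain L where "\<forall>y\<in>f ` cball 0 R. norm y \<le> L"
    using compact_imp_bounded bounded_iff by blast
  then show ?thesis
    by (intro that[of "max L 0"]) (auto simp: le_max_iff_disj)
qed

lemma partial_deriv_eq:
  "(f has_derivative f') (at x) \<Longrightarrow> partial_deriv i f x = f' (axis i 1)"
  by (metis partial_deriv_def frechet_derivative_at)

lemma has_derivative_grad:
  fixes f :: "real^'n::finite \<Rightarrow> real"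
  assumes "f differentiable (at x)"
  shows "(f has_derivative (\<lambda>h. grad f x \<bullet> h)) (at x)"
proof -
  let ?D = "frechet_derivative f (at x)"
  have D: "(f has_derivative ?D) (at x)"
    using assms frechet_derivative_works by blast
  then have lin: "linear ?D"
    by (rule has_derivative_linear)
  have "?D h = grad f x \<bullet> h" for h
  proof -
    have "?D h = ?D (\<Sum>i\<in>UNIV. h $ i *\<^sub>R axis i 1)"
      using basis_expansion[of h] by (simp add: scalar_mult_eq_scaleR)
    also have "\<dots> = (\<Sum>i\<in>UNIV. h $ i * ?D (axis i 1))"
      by (simp add: linear_sum[OF lin] linear_scale[OF lin])
    finally show ?thesis
      by (simp add: inner_vec_def grad_def partial_deriv_def mult.commute)
  qed
  then show ?thesis
    using D by (metis (no_types, lifting) ext)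
qed

lemma grad_eqI:
  fixes f :: "real^'n::finite \<Rightarrow> real"
  assumes "(f has_derivative (\<lambda>h. v \<bullet> h)) (at x)"
  shows "grad f x = v"
  by (simp add: vec_eq_iff grad_def partial_deriv_eq[OF assms] inner_axis)

lemma partial_deriv_mult:
  fixes f g :: "real^'n::finite \<Rightarrow> real"
  assumes "f differentiable (at x)" "g differentiable (at x)"
  shows "partial_deriv i (\<lambda>x. f x * g x) x = f x * partial_deriv i g x + partial_deriv i f x * g x"
  using assms by (auto simp: grad_def inner_axis
      intro!: partial_deriv_eq[THEN trans] derivative_eq_intros has_derivative_grad)

lemma partial_deriv_uminus:
  fixes f :: "real^'n::finite \<Rightarrow> real"
  assumes "f differentiable (at x)"
  shows "partial_deriv i (\<lambda>x. - f x) x = - partial_deriv i f x"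
  using assms by (auto simp: grad_def inner_axis
      intro!: partial_deriv_eq[THEN trans] derivative_eq_intros has_derivative_grad)

lemma Ck_SucD: "Ck (Suc k) f \<Longrightarrow> Ck k f"
proof (induction k arbitrary: f)
  case 0
  then show ?case
    by (auto intro!: continuous_at_imp_continuous_on differentiable_imp_continuous_within)
qed auto

lemma Ck_imp_continuous: "Ck k f \<Longrightarrow> continuous_on UNIV f"
proof (induction k)
  case (Suc k)
  then show ?case using Ck_SucD by blast
qed simp

lemma Ck_const: "Ck k (\<lambda>x. c)"
proof (induction k arbitrary: c)
  case (Suc k)
  have "partial_deriv i (\<lambda>x. c) = (\<lambda>x. 0)" for i :: 'a
    by (auto simp: fun_eq_iff intro!: partial_deriv_eq[THEN trans] derivative_eq_intros)
  then show ?case using Suc by simp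
qed simp

lemma Ck_add: "Ck k f \<Longrightarrow> Ck k g \<Longrightarrow> Ck k (\<lambda>x. f x + g x)"
proof (induction k arbitrary: f g)
  case 0
  then show ?case by (auto intro: continuous_intros)
next
  case (Suc k)
  have "partial_deriv i (\<lambda>x. f x + g x) = (\<lambda>x. partial_deriv i f x + partial_deriv i g x)" for i
    using Suc.prems
    by (auto simp: fun_eq_iff grad_def inner_axis inner_add_left
        intro!: partial_deriv_eq[THEN trans] derivative_eq_intros has_derivative_grad)
  then show ?case using Suc by simp
qed

lemma Ck_mult: "Ck k f \<Longrightarrow> Ck k g \<Longrightarrow> Ck k (\<lambda>x. f x * g x)"
proof (induction k arbitrary: f g)
  case 0
  then show ?case by (auto intro: continuous_intros)
next
  case (Suc k)
  have "partial_deriv i (\<lambda>x. f x * g x) = (\<lambda>x. f x * partial_deriv i g x + partial_deriv i f x * g x)" for i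
    using Suc.prems
    by (simp add: fun_eq_iff partial_deriv_mult)
  then show ?case using Suc Suc.prems[THEN Ck_SucD] by (simp add: Ck_add)
qed

lemma Ck_uminus: "Ck k f \<Longrightarrow> Ck k (\<lambda>x. - f x)"
  using Ck_mult[OF Ck_const[of k "-1"]] by simp

lemma Ck_inverse:
  assumes "\<And>x. f x \<noteq> 0"
  shows "Ck k f \<Longrightarrow> Ck k (\<lambda>x. inverse (f x))"
proof (induction k)
  case 0
  then show ?case using assms by (auto intro: continuous_intros)
next
  case (Suc k)
  have "partial_deriv i (\<lambda>x. inverse (f x)) = (\<lambda>x. - (inverse (f x) * partial_deriv i f x * inverse (f x)))" for i
    using Suc.prems assms
    by (auto simp: fun_eq_iff grad_def inner_axis inner_add_left
        intro!: partial_deriv_eq[THEN trans] derivative_eq_intros has_derivative_grad)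
  \<comment> \<open>The derivative formula contains the inverse itself, which the induction
    hypothesis covers at order \<open>k\<close>.\<close>
  moreover have "Ck k (\<lambda>x. inverse (f x))"
    using Suc Ck_SucD by blast
  ultimately show ?case using Suc.prems assms by (auto intro!: Ck_uminus Ck_mult)
qed

lemma Ck_sum: "(\<And>i. i \<in> I \<Longrightarrow> Ck k (f i)) \<Longrightarrow> Ck k (\<lambda>x. \<Sum>i\<in>I. f i x)"
  by (induction I rule: infinite_finite_induct) (auto simp: Ck_const Ck_add)

lemma Ck_1_iff_grad:
  fixes f :: "real^'n::finite \<Rightarrow> real"
  shows "Ck 1 f \<longleftrightarrow> (\<forall>x. f differentiable (at x)) \<and> continuous_on UNIV (grad f)"
proof -
  have "continuous_on UNIV (grad f) \<longleftrightarrow> (\<forall>i. continuous_on UNIV (partial_deriv i f))"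
    unfolding grad_def
    by (auto intro!: continuous_on_vec_lambda dest: continuous_on_component)
  then show ?thesis by simp
qed

lemma Ck_1I:
  fixes f :: "real^'n::finite \<Rightarrow> real"
  assumes "\<And>x. (f has_derivative blinfun_apply (f' x)) (at x)" "continuous_on UNIV f'"
  shows "Ck 1 f"
proof -
  have "partial_deriv i f = (\<lambda>x. f' x (axis i 1))" for i
    using assms(1) by (auto simp: fun_eq_iff intro: partial_deriv_eq)
  then show ?thesis
    using assms by (auto simp: differentiable_def intro!: continuous_intros)
qed

text \<open>Mean value inequality on the convex ball, with the gradient bounded there by
  compactness.\<close>

lemma Ck_1_lipschitz_on_cball:
  fixes f :: "real^'n::finite \<Rightarrow> real"
  assumes "Ck 1 f"
  shows "\<exists>L. L-lipschitz_on (cball 0 R) f"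
proof -
  obtain L where "0 \<le> L" and L: "\<And>x. norm x \<le> R \<Longrightarrow> norm (grad f x) \<le> L"
    using continuous_bounded_on_cball[OF conjunct2[OF assms[unfolded Ck_1_iff_grad]]] by blast
  have "norm (f x - f y) \<le> L * norm (x - y)" if "x \<in> cball 0 R" "y \<in> cball 0 R" for x y
  proof (rule differentiable_bound[where S="cball 0 R" and f'="\<lambda>x h. grad f x \<bullet> h"])
    show "(f has_derivative (\<lambda>h. grad f x \<bullet> h)) (at x within cball 0 R)" for x
      using assms by (simp add: has_derivative_at_withinI[OF has_derivative_grad])
    show "onorm (\<lambda>h. grad f x \<bullet> h) \<le> L" if "x \<in> cball 0 R" for x
      using L[of x] that onorm_inner_right[of "\<lambda>h. h" "grad f x"] onorm_id_le[where 'a="real^'n"]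
        mult_left_mono[of "onorm (\<lambda>h::real^'n. h)" 1 "norm (grad f x)"] by (simp add: bounded_linear_ident)
  qed (use that in auto)
  then show ?thesis
    by (intro exI[of _ L] lipschitz_onI) (auto simp: dist_norm \<open>0 \<le> L\<close>)
qed

section \<open>The flow of a bounded vector field\<close>

lemma norm_integral_le_bound:
  fixes g :: "real \<Rightarrow> 'b::banach"
  assumes "continuous_on {0..1} g" "\<And>r. 0 \<le> r \<Longrightarrow> r \<le> 1 \<Longrightarrow> norm (g r) \<le> K"
  shows "norm (integral {0..1} g) \<le> K"
  using integral_bound[of 0 1 g K] assms by auto

lemma integral_continuous_diff:
  fixes f g :: "real \<Rightarrow> 'b::banach"
  assumes "continuous_on {0..1} f" "continuous_on {0..1} g"
  shows "integral {0..1} f - integral {0..1} g = integral {0..1} (\<lambda>r. f r - g r)"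
  using assms by (simp add: integral_diff integrable_continuous_interval)

text \<open>Weighting by \<open>exp (l * \<bar>t\<bar>)\<close> gains a factor \<open>1 / l\<close> per integration: it turns the Picard operator
  into a contraction on arbitrarily long time intervals.\<close>

lemma norm_scaled_integral_le_exp:
  fixes g :: "real \<Rightarrow> 'b::banach"
  assumes g: "continuous_on {0..1} g" and "0 < l" "0 \<le> K"
    and le: "\<And>r. 0 \<le> r \<Longrightarrow> r \<le> 1 \<Longrightarrow> norm (g r) \<le> K * exp (l * (r * \<bar>t\<bar>))"
  shows "norm (t *\<^sub>R integral {0..1} g) \<le> K / l * exp (l * \<bar>t\<bar>)"
proof -
  \<comment> \<open>Keeping the factor \<open>\<bar>t\<bar>\<close> in the integrand gives the
    antiderivative \<open>K / l * exp (l * (r * \<bar>t\<bar>))\<close> for every \<open>t\<close>,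
    including \<open>t = 0\<close>.\<close>
  have I: "((\<lambda>r. \<bar>t\<bar> * (K * exp (l * (r * \<bar>t\<bar>)))) has_integral
     K / l * exp (l * (1 * \<bar>t\<bar>)) - K / l * exp (l * (0 * \<bar>t\<bar>))) {0..1}"
    using \<open>0 < l\<close>
    by (intro fundamental_theorem_of_calculus)
      (auto simp: has_real_derivative_iff_has_vector_derivative[symmetric] intro!: derivative_eq_intros)
  have "norm (t *\<^sub>R integral {0..1} g) = norm (integral {0..1} (\<lambda>r. t *\<^sub>R g r))"
    by simp
  also have "\<dots> \<le> integral {0..1} (\<lambda>r. \<bar>t\<bar> * (K * exp (l * (r * \<bar>t\<bar>))))"
    using g le I
    by (intro integral_norm_bound_integral)
      (auto intro!: integrable_continuous_interval continuous_intros mult_left_mono)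
  also have "\<dots> \<le> K / l * exp (l * \<bar>t\<bar>)"
    using integral_unique[OF I] assms(2,3) by simp
  finally show ?thesis .
qed

text \<open>A bounded linear map depending affinely on \<open>r\<close>: in the chain rule it
  appears as a composition factor, and continuity in \<open>r\<close> is immediate.\<close>

definition time_scale :: "real \<Rightarrow> (real \<times> 'a::real_normed_vector) \<Rightarrow>\<^sub>L (real \<times> 'a)" where
  "time_scale r = r *\<^sub>R Blinfun (\<lambda>p. (fst p, 0)) + Blinfun (\<lambda>p. (0, snd p))"

lemma time_scale_apply: "time_scale r p = (r * fst p, snd p)"
proof -
  have "bounded_linear (\<lambda>p::real \<times> 'a. (fst p, 0::'a))" "bounded_linear (\<lambda>p::real \<times> 'a. (0::real, snd p))"
    by (intro bounded_linear_intros)+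
  then show ?thesis
    by (simp add: time_scale_def blinfun.bilinear_simps bounded_linear_Blinfun_apply)
qed

lemma continuous_on_time_scale [continuous_intros]:
  "continuous_on S f \<Longrightarrow> continuous_on S (\<lambda>x. time_scale (f x))"
  unfolding time_scale_def by (intro continuous_intros)

lemma norm_time_scale_le: "0 \<le> r \<Longrightarrow> r \<le> 1 \<Longrightarrow> norm (time_scale r) \<le> 1"
proof (rule norm_blinfun_bound)
  fix p :: "real \<times> 'a"
  assume "0 \<le> r" "r \<le> 1"
  then have "(r * fst p)\<^sup>2 \<le> (fst p)\<^sup>2"
    by (simp add: abs_le_square_iff[symmetric] abs_mult mult_left_le_one_le)
  then show "norm (time_scale r p) \<le> 1 * norm p"
    by (simp add: time_scale_apply norm_Pair norm_prod_def)
qed simp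

text \<open>Bounding time and space separately suits estimates in which the two play different
  roles. The boxes are preserved by \<open>time_scale r\<close> for \<open>r\<close> in [0, 1], and
  every point is interior to one of them.\<close>

abbreviation box0 :: "real \<Rightarrow> (real \<times> 'a::real_normed_vector) set" where
  "box0 R \<equiv> cball 0 R \<times> cball 0 R"

lemma in_interior_box0: "p \<in> interior (box0 (norm p + 1))"
proof -
  have "norm (fst p) < norm p + 1" "norm (snd p) < norm p + 1"
    using norm_fst_le[of "fst p" "snd p"] norm_snd_le[of "snd p" "fst p"] by simp_all
  then have "p \<in> ball 0 (norm p + 1) \<times> ball 0 (norm p + 1)"
    by (simp add: mem_Times_iff)
  moreover have "ball 0 (norm p + 1) \<times> ball 0 (norm p + 1) \<subseteq> box0 (norm p + 1)"
    by (intro Sigma_mono ball_subset_cball)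
  ultimately show ?thesis
    by (intro interiorI[OF open_Times[OF open_ball open_ball]])
qed

text \<open>Weierstrass M-test for the telescoping series. The sum is defined without reference to
  \<open>R\<close>, so one limit function serves all the sets \<open>K R\<close>.\<close>

lemma uniform_limit_of_geometric_steps:
  fixes f :: "nat \<Rightarrow> 'p \<Rightarrow> 'b::banach"
  assumes "\<And>R::real. \<exists>C. \<forall>n. \<forall>p\<in>K R. norm (f (Suc n) p - f n p) \<le> C / 2 ^ n"
  shows "\<exists>g. \<forall>R. uniform_limit (K R) f g sequentially"
proof -
  let ?g = "\<lambda>p. f 0 p + (\<Sum>i. f (Suc i) p - f i p)"
  have "uniform_limit (K R) f ?g sequentially" for R
  proof -
    obtain C where C: "\<And>n p. p \<in> K R \<Longrightarrow> norm (f (Suc n) p - f n p) \<le> C * (1/2) ^ n"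
      using assms[of R] by (auto simp: power_divide)
    have "uniform_limit (K R) (\<lambda>n p. \<Sum>i<n. f (Suc i) p - f i p) (\<lambda>p. \<Sum>i. f (Suc i) p - f i p) sequentially"
      by (rule Weierstrass_m_test[OF C]) (auto intro!: summable_mult summable_geometric)
    then have "uniform_limit (K R) (\<lambda>n p. f 0 p + (\<Sum>i<n. f (Suc i) p - f i p)) ?g sequentially"
      by (intro uniform_limit_intros)
    then show ?thesis
      using sum_lessThan_telescope[of "\<lambda>n. f n p" for p] by simp
  qed
  then show ?thesis by blast
qed

text \<open>The bound \<open>B\<close> keeps trajectories from escaping in finite time, so the flow
  is global. The Lipschitz condition on the derivative is the form in which C^2 regularity of the
  field enters.\<close>

locale bounded_field =
  fixes Y :: "'a::euclidean_space \<Rightarrow> 'a" and Y' :: "'a \<Rightarrow> 'a \<Rightarrow>\<^sub>L 'a" and B :: real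
  assumes Y_deriv: "\<And>x. (Y has_derivative blinfun_apply (Y' x)) (at x)"
    and Y_bound: "\<And>x. norm (Y x) \<le> B"
    and Y'_lipschitz: "\<And>R. \<exists>L. L-lipschitz_on (cball 0 R) Y'"
begin

lemma B_nonneg: "0 \<le> B"
  using Y_bound norm_ge_zero order_trans by blast

lemma Y_continuous: "continuous_on UNIV Y"
  using Y_deriv by (meson continuous_at_imp_continuous_on has_derivative_continuous)

lemma Y'_continuous: "continuous_on UNIV Y'"
proof (rule continuous_at_imp_continuous_on, rule ballI)
  fix x :: 'a
  obtain L where "L-lipschitz_on (cball 0 (norm x + 1)) Y'"
    using Y'_lipschitz by blast
  then have "continuous_on (ball 0 (norm x + 1)) Y'"
    by (rule continuous_on_subset[OF lipschitz_on_continuous_on ball_subset_cball])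
  then show "isCont Y' x"
    by (rule continuous_on_interior) simp
qed

lemmas Y_continuous_intros [continuous_intros] =
  continuous_on_compose2[OF Y_continuous _ subset_UNIV]
  continuous_on_compose2[OF Y'_continuous _ subset_UNIV]

lemma Y_local_bounds:
  obtains L where "1 \<le> L"
    "\<And>x. norm x \<le> R \<Longrightarrow> norm (Y' x) \<le> L"
    "\<And>x y. norm x \<le> R \<Longrightarrow> norm y \<le> R \<Longrightarrow> norm (Y x - Y y) \<le> L * norm (x - y)"
    "\<And>x y. norm x \<le> R \<Longrightarrow> norm y \<le> R \<Longrightarrow> norm (Y' x - Y' y) \<le> L * norm (x - y)"
proof -
  obtain L1 where L1: "L1-lipschitz_on (cball 0 R) Y'"
    using Y'_lipschitz by blast
  obtain L2 where L2: "\<And>x. norm x \<le> R \<Longrightarrow> norm (Y' x) \<le> L2"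
    using continuous_bounded_on_cball[OF Y'_continuous] by blast
  define L where "L = max 1 (max L1 L2)"
  show ?thesis
  proof
    show "1 \<le> L" by (simp add: L_def)
    show "norm (Y' x) \<le> L" if "norm x \<le> R" for x
      using L2[of x] that by (simp add: L_def)
    show "norm (Y x - Y y) \<le> L * norm (x - y)" if "norm x \<le> R" "norm y \<le> R" for x y
    proof (rule differentiable_bound[where S="cball 0 R" and f'="\<lambda>x. blinfun_apply (Y' x)"])
      show "onorm (blinfun_apply (Y' x)) \<le> L" if "x \<in> cball 0 R" for x
        using L2[of x] that by (simp add: L_def flip: norm_blinfun.rep_eq)
    qed (use that in \<open>simp_all add: has_derivative_at_withinI[OF Y_deriv]\<close>)
    show "norm (Y' x - Y' y) \<le> L * norm (x - y)" if "norm x \<le> R" "norm y \<le> R" for x y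
    proof -
      have "norm (Y' x - Y' y) \<le> L1 * norm (x - y)"
        using lipschitz_on_normD[OF L1] that by simp
      also have "\<dots> \<le> L * norm (x - y)"
        by (intro mult_right_mono) (auto simp: L_def)
      finally show ?thesis .
    qed
  qed
qed

text \<open>The Picard operator for \<open>\<partial>\<psi>/\<partial>t = Y \<circ> \<psi>\<close>, \<open>\<psi>(0, x) = x\<close>, with \<open>\<integral>\<^sub>0\<^sup>t\<close> rescaled to \<open>[0, 1]\<close>: the
  integration domain no longer depends on \<open>(t, x)\<close>, so differentiating under the integral sign
  gives joint regularity in time and space.\<close>

definition step :: "(real \<times> 'a \<Rightarrow> 'a) \<Rightarrow> real \<times> 'a \<Rightarrow> 'a" where
  "step f p = snd p + fst p *\<^sub>R integral {0..1} (\<lambda>r. Y (f (time_scale r p)))"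

definition step' ::
  "(real \<times> 'a \<Rightarrow> 'a) \<Rightarrow> (real \<times> 'a \<Rightarrow> (real \<times> 'a) \<Rightarrow>\<^sub>L 'a) \<Rightarrow> real \<times> 'a \<Rightarrow> (real \<times> 'a) \<Rightarrow>\<^sub>L 'a"
where
  "step' f f' p = snd_blinfun
     + (blinfun_scaleR_left (integral {0..1} (\<lambda>r. Y (f (time_scale r p)))) o\<^sub>L fst_blinfun)
     + fst p *\<^sub>R integral {0..1} (\<lambda>r. Y' (f (time_scale r p)) o\<^sub>L f' (time_scale r p) o\<^sub>L time_scale r)"

text \<open>Differentiation under an integral over a fixed interval. The three summands of
  \<open>step'\<close> stem from the initial point \<open>snd p\<close>, from the factor
  \<open>fst p\<close> and from the integrand.\<close>

lemma step_C1:
  assumes f: "\<And>p. (f has_derivative blinfun_apply (f' p)) (at p)" and f': "continuous_on UNIV f'"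
  shows "(step f has_derivative blinfun_apply (step' f f' p)) (at p)"
    and "continuous_on UNIV (step' f f')"
proof -
  have fc: "continuous_on UNIV f"
    using f by (meson continuous_at_imp_continuous_on has_derivative_continuous)
  note [continuous_intros] =
    continuous_on_compose2[OF fc _ subset_UNIV] continuous_on_compose2[OF f' _ subset_UNIV]
  define g where "g r p = Y (f (time_scale r p))" for r p
  define g' where "g' r p = Y' (f (time_scale r p)) o\<^sub>L f' (time_scale r p) o\<^sub>L time_scale r" for r p
  have gd: "(g r has_derivative blinfun_apply (g' r p)) (at p)" for r p
  proof -
    have "((\<lambda>p. f (time_scale r p)) has_derivative (\<lambda>h. f' (time_scale r p) (time_scale r h))) (at p)"
      by (rule has_derivative_compose[OF _ f])
        (intro bounded_linear_imp_has_derivative blinfun.bounded_linear_right)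
    from has_derivative_compose[OF this Y_deriv] show ?thesis
      by (simp add: g_def[abs_def] g'_def blinfun_compose.rep_eq o_def)
  qed
  have gc: "continuous_on UNIV (\<lambda>(p, r). g r p)" "continuous_on UNIV (\<lambda>(p, r). g' r p)"
    unfolding g_def g'_def by (auto simp: split_beta intro!: continuous_intros)
  have ic: "continuous_on UNIV (\<lambda>p. integral (cbox 0 1) (\<lambda>r. g r p))"
    "continuous_on UNIV (\<lambda>p. integral (cbox 0 1) (\<lambda>r. g' r p))"
    by (intro integral_continuous_on_param continuous_on_subset[OF gc(1)] continuous_on_subset[OF gc(2)] subset_UNIV)+
  have id: "((\<lambda>p. integral (cbox 0 1) (\<lambda>r. g r p)) has_derivative
      blinfun_apply (integral (cbox 0 1) (\<lambda>r. g' r p))) (at p)" for p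
  proof (rule leibniz_rule[where U=UNIV])
    show "(\<lambda>r. g r x) integrable_on cbox 0 1" for x
      unfolding g_def by (intro integrable_continuous continuous_intros)
  qed (use gd gc(2) in \<open>auto intro: continuous_on_subset\<close>)
  show "continuous_on UNIV (step' f f')"
    using ic unfolding step'_def g_def g'_def by (auto intro!: continuous_intros)
  show "(step f has_derivative blinfun_apply (step' f f' p)) (at p)"
  proof (rule has_derivative_eq_rhs)
    show "(step f has_derivative
        (\<lambda>h. snd h + (fst p *\<^sub>R integral (cbox 0 1) (\<lambda>r. g' r p) h + fst h *\<^sub>R integral (cbox 0 1) (\<lambda>r. g r p)))) (at p)"
      unfolding step_def[abs_def] g_def[symmetric] cbox_interval[symmetric]
      by (intro has_derivative_add has_derivative_scaleR id
          bounded_linear_imp_has_derivative bounded_linear_fst bounded_linear_snd)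
  qed (simp add: step'_def g_def g'_def fun_eq_iff blinfun.bilinear_simps)
qed

section \<open>Picard iterates and their derivatives\<close>

fun picard :: "nat \<Rightarrow> real \<times> 'a \<Rightarrow> 'a" where
  "picard 0 = snd"
| "picard (Suc n) = step (picard n)"

fun picard' :: "nat \<Rightarrow> real \<times> 'a \<Rightarrow> (real \<times> 'a) \<Rightarrow>\<^sub>L 'a" where
  "picard' 0 = (\<lambda>p. snd_blinfun)"
| "picard' (Suc n) = step' (picard n) (picard' n)"

lemma picard_C1:
  "(picard n has_derivative blinfun_apply (picard' n p)) (at p)" "continuous_on UNIV (picard' n)"
proof -
  have "(\<forall>p. (picard n has_derivative blinfun_apply (picard' n p)) (at p)) \<and> continuous_on UNIV (picard' n)"
  proof (induction n)
    case 0
    then show ?case by (auto intro!: derivative_eq_intros)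
  next
    case (Suc n)
    then show ?case by (auto intro!: step_C1)
  qed
  note * = this
  show "(picard n has_derivative blinfun_apply (picard' n p)) (at p)"
    by (rule spec[OF conjunct1[OF *]])
  show "continuous_on UNIV (picard' n)"
    by (rule conjunct2[OF *])
qed

lemma picard_continuous: "continuous_on UNIV (picard n)"
  using picard_C1(1) by (meson continuous_at_imp_continuous_on has_derivative_continuous)

lemmas picard_continuous_intros [continuous_intros] =
  continuous_on_compose2[OF picard_continuous _ subset_UNIV]
  continuous_on_compose2[OF picard_C1(2) _ subset_UNIV]

text \<open>The bound is uniform in \<open>n\<close>: over a given box all iterates stay in one
  ball, where a single Lipschitz constant for \<open>Y\<close> and \<open>Y'\<close>
  applies.\<close>

lemma norm_picard_le: "norm (picard n p) \<le> norm (snd p) + \<bar>fst p\<bar> * B"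
proof (cases n)
  case (Suc m)
  have "norm (integral {0..1} (\<lambda>r. Y (picard m (time_scale r p)))) \<le> B"
    by (intro norm_integral_le_bound continuous_intros Y_bound)
  then have "norm (fst p *\<^sub>R integral {0..1} (\<lambda>r. Y (picard m (time_scale r p)))) \<le> \<bar>fst p\<bar> * B"
    by (simp add: mult_left_mono)
  then show ?thesis
    unfolding Suc picard.simps step_def by (intro norm_triangle_mono order_refl)
qed (use B_nonneg in simp)

lemma step_diff:
  assumes f: "continuous_on UNIV f" and g: "continuous_on UNIV g"
  shows "step f p - step g p =
    fst p *\<^sub>R integral {0..1} (\<lambda>r. Y (f (time_scale r p)) - Y (g (time_scale r p)))"
proof -
  note [continuous_intros] =
    continuous_on_compose2[OF f _ subset_UNIV] continuous_on_compose2[OF g _ subset_UNIV]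
  show ?thesis
    unfolding step_def add_diff_cancel_left scaleR_diff_right[symmetric]
    by (subst integral_continuous_diff) (intro continuous_intros refl)+
qed

lemma step'_diff:
  assumes f: "continuous_on UNIV f" and f': "continuous_on UNIV f'"
    and g: "continuous_on UNIV g" and g': "continuous_on UNIV g'"
  shows "step' f f' p - step' g g' p =
    (blinfun_scaleR_left (integral {0..1} (\<lambda>r. Y (f (time_scale r p)) - Y (g (time_scale r p)))) o\<^sub>L fst_blinfun)
    + fst p *\<^sub>R integral {0..1} (\<lambda>r.
        (Y' (f (time_scale r p)) o\<^sub>L f' (time_scale r p) o\<^sub>L time_scale r)
      - (Y' (g (time_scale r p)) o\<^sub>L g' (time_scale r p) o\<^sub>L time_scale r))"
proof -
  note [continuous_intros] =
    continuous_on_compose2[OF f _ subset_UNIV] continuous_on_compose2[OF g _ subset_UNIV]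
    continuous_on_compose2[OF f' _ subset_UNIV] continuous_on_compose2[OF g' _ subset_UNIV]
  have *: "continuous_on {0..1} (\<lambda>r. Y (f (time_scale r p)))" "continuous_on {0..1} (\<lambda>r. Y (g (time_scale r p)))"
    "continuous_on {0..1} (\<lambda>r. Y' (f (time_scale r p)) o\<^sub>L f' (time_scale r p) o\<^sub>L time_scale r)"
    "continuous_on {0..1} (\<lambda>r. Y' (g (time_scale r p)) o\<^sub>L g' (time_scale r p) o\<^sub>L time_scale r)"
    by (intro continuous_intros)+
  show ?thesis
    unfolding step'_def integral_continuous_diff[OF *(1,2), symmetric] integral_continuous_diff[OF *(3,4), symmetric]
    by (rule blinfun_eqI) (simp add: blinfun.bilinear_simps algebra_simps)
qed

lemma norm_rank_one_le:
  assumes "norm v \<le> K"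
  shows "norm (blinfun_scaleR_left v o\<^sub>L (fst_blinfun :: (real \<times> 'a) \<Rightarrow>\<^sub>L real)) \<le> K"
proof (rule norm_blinfun_bound)
  show "0 \<le> K"
    using assms norm_ge_zero order_trans by blast
  show "norm ((blinfun_scaleR_left v o\<^sub>L (fst_blinfun :: (real \<times> 'a) \<Rightarrow>\<^sub>L real)) p) \<le> K * norm p" for p
    using mult_mono[OF norm_fst_le[of "fst p" "snd p"] assms] by (simp add: mult.commute)
qed

text \<open>All differences are measured against the weight \<open>E p\<close>, in which an
  integration in time gains 1 / \<open>l\<close>. The iterates are treated first, because the
  recursion for the derivatives contains differences of \<open>Y\<close> and \<open>Y'\<close> at
  consecutive iterates; these decay geometrically by the Lipschitz bounds and act as a source
  term.\<close>

lemma picard_Cauchy: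
  "\<exists>C. \<forall>n. \<forall>p\<in>box0 R. norm (picard (Suc n) p - picard n p) \<le> C / 2 ^ n \<and>
     norm (picard' (Suc n) p - picard' n p) \<le> C / 2 ^ n"
proof -
  define S where "S = R + R * B"
  obtain L where "1 \<le> L" and LY': "\<And>x. norm x \<le> S \<Longrightarrow> norm (Y' x) \<le> L"
    and lipY: "\<And>x y. norm x \<le> S \<Longrightarrow> norm y \<le> S \<Longrightarrow> norm (Y x - Y y) \<le> L * norm (x - y)"
    and lipY': "\<And>x y. norm x \<le> S \<Longrightarrow> norm y \<le> S \<Longrightarrow> norm (Y' x - Y' y) \<le> L * norm (x - y)"
    using Y_local_bounds[of S] by blast
  \<comment> \<open>One step costs a factor \<open>L\<close> and gains 1 / \<open>l\<close>, in
    total 1/8. A factor 1/2 is the target; the surplus absorbs the source terms in the estimates for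
    the derivatives.\<close>
  define l where "l = 8 * L"
  have "0 < l" using \<open>1 \<le> L\<close> by (simp add: l_def)
  define E :: "real \<times> 'a \<Rightarrow> real" where "E p = exp (l * \<bar>fst p\<bar>)" for p
  have E_ge_1: "1 \<le> E p" for p
    using \<open>0 < l\<close> by (simp add: E_def)
  have E_scale: "E (time_scale r p) = exp (l * (r * \<bar>fst p\<bar>))" if "0 \<le> r" for r p
    using that by (simp add: E_def time_scale_apply abs_mult)
  have E_scale_le: "E (time_scale r p) \<le> E p" if "0 \<le> r" "r \<le> 1" for r p
    using that \<open>0 < l\<close> by (simp add: E_scale, simp add: E_def mult_left_le_one_le)
  have scale_box: "time_scale r p \<in> box0 R" if "p \<in> box0 R" "0 \<le> r" "r \<le> 1" for r and p :: "real \<times> 'a"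
    using that by (auto simp: time_scale_apply abs_mult mem_Times_iff intro: order_trans[OF mult_left_le_one_le])
  have inS: "norm (picard n p) \<le> S" if "p \<in> box0 R" for n p
  proof -
    have "norm (snd p) \<le> R" "\<bar>fst p\<bar> * B \<le> R * B"
      using that B_nonneg by (auto simp: mem_Times_iff intro: mult_right_mono)
    then show ?thesis
      using norm_picard_le[of n p] by (simp add: S_def)
  qed
  \<comment> \<open>The summands of \<open>step'\<close> outside the weighted integral contribute at
    most 1 + \<open>B\<close>, and the integral at most \<open>M / 8 * E p\<close>; twice 1 +
    \<open>B\<close> is enough for the bound to reproduce itself.\<close>
  define M where "M = 2 * (1 + B)"
  have p'_bound: "norm (picard' n p) \<le> M * E p" if "p \<in> box0 R" for n p
    using that
  proof (induction n arbitrary: p)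
    case 0
    have "norm (snd_blinfun :: (real \<times> 'a) \<Rightarrow>\<^sub>L 'a) \<le> 1"
      by (rule norm_blinfun_bound) (auto simp: norm_snd_le split: prod.split)
    also have "1 \<le> M * E p"
      using B_nonneg E_ge_1[of p] mult_mono[of 1 M 1 "E p"] by (simp add: M_def)
    finally show ?case by simp
  next
    case (Suc n)
    have 1: "norm (snd_blinfun :: (real \<times> 'a) \<Rightarrow>\<^sub>L 'a) \<le> 1"
      by (rule norm_blinfun_bound) (auto simp: norm_snd_le split: prod.split)
    have 2: "norm (blinfun_scaleR_left (integral {0..1} (\<lambda>r. Y (picard n (time_scale r p)))) o\<^sub>L
       (fst_blinfun :: (real \<times> 'a) \<Rightarrow>\<^sub>L real)) \<le> B"
      by (intro norm_rank_one_le norm_integral_le_bound continuous_intros Y_bound)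
    have 3: "norm (fst p *\<^sub>R integral {0..1} (\<lambda>r. Y' (picard n (time_scale r p)) o\<^sub>L
          picard' n (time_scale r p) o\<^sub>L time_scale r)) \<le> L * M / l * E p"
      unfolding E_def
    proof (rule norm_scaled_integral_le_exp)
      fix r :: real assume r: "0 \<le> r" "r \<le> 1"
      have "norm (Y' (picard n (time_scale r p)) o\<^sub>L picard' n (time_scale r p) o\<^sub>L time_scale r)
        \<le> norm (Y' (picard n (time_scale r p))) * norm (picard' n (time_scale r p)) * norm (time_scale r :: (real \<times> 'a) \<Rightarrow>\<^sub>L _)"
        by (meson mult_right_mono norm_blinfun_compose norm_ge_zero order_trans)
      also have "\<dots> \<le> L * (M * E (time_scale r p)) * 1"
        using Suc.IH[OF scale_box[OF Suc.prems r]] LY'[OF inS[OF scale_box[OF Suc.prems r]]] \<open>1 \<le> L\<close> r B_nonneg E_ge_1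
        by (intro mult_mono mult_nonneg_nonneg norm_time_scale_le) (auto simp: M_def E_def)
      finally show "norm (Y' (picard n (time_scale r p)) o\<^sub>L picard' n (time_scale r p) o\<^sub>L time_scale r)
        \<le> L * M * exp (l * (r * \<bar>fst p\<bar>))"
        using r by (simp add: E_scale)
    qed (use \<open>0 < l\<close> \<open>1 \<le> L\<close> B_nonneg in \<open>auto simp: M_def intro!: continuous_intros\<close>)
    have "norm (picard' (Suc n) p) \<le> 1 + B + L * M / l * E p"
      unfolding picard'.simps step'_def by (intro norm_triangle_mono 1 2 3)
    also have "L * M / l = M / 8"
      using \<open>1 \<le> L\<close> by (simp add: l_def)
    also have "1 + B + M / 8 * E p \<le> (1 + B) * E p + M / 8 * E p"
      using E_ge_1[of p] B_nonneg mult_left_mono[of 1 "E p" "1 + B"] by simp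
    also have "\<dots> \<le> M * E p"
      using B_nonneg E_ge_1[of p] by (simp add: M_def algebra_simps)
    finally show ?case .
  qed
  \<comment> \<open>Contraction in the weighted norm: the factor 1/8 gained per step is recorded as
    1/2.\<close>
  have d_bound: "norm (picard (Suc n) p - picard n p) \<le> B / 2 ^ n * E p" if "p \<in> box0 R" for n p
    using that
  proof (induction n arbitrary: p)
    case 0
    have "norm (fst p *\<^sub>R integral {0..1} (\<lambda>r. Y (picard 0 (time_scale r p)))) \<le> B / l * E p"
      unfolding E_def
    proof (rule norm_scaled_integral_le_exp)
      fix r :: real assume r: "0 \<le> r" "r \<le> 1"
      have "norm (Y (picard 0 (time_scale r p))) \<le> B * 1"
        using Y_bound by simp
      also have "\<dots> \<le> B * exp (l * (r * \<bar>fst p\<bar>))"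
        using B_nonneg r \<open>0 < l\<close> by (intro mult_left_mono) auto
      finally show "norm (Y (picard 0 (time_scale r p))) \<le> B * exp (l * (r * \<bar>fst p\<bar>))" .
    qed (use \<open>0 < l\<close> B_nonneg in \<open>auto intro!: continuous_intros\<close>)
    also have "\<dots> \<le> B * E p"
      using \<open>1 \<le> L\<close> B_nonneg E_ge_1[of p] mult_left_mono[of 1 "L * 8" B]
      by (intro mult_right_mono) (auto simp: l_def field_simps)
    finally show ?case by (simp add: step_def)
  next
    case (Suc n)
    have "norm (fst p *\<^sub>R integral {0..1} (\<lambda>r. Y (picard (Suc n) (time_scale r p)) - Y (picard n (time_scale r p))))
        \<le> L * (B / 2 ^ n) / l * E p"
      unfolding E_def
    proof (rule norm_scaled_integral_le_exp)
      fix r :: real assume r: "0 \<le> r" "r \<le> 1"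
      note b = scale_box[OF Suc.prems r]
      have "norm (Y (picard (Suc n) (time_scale r p)) - Y (picard n (time_scale r p)))
        \<le> L * norm (picard (Suc n) (time_scale r p) - picard n (time_scale r p))"
        by (intro lipY inS b)
      also have "\<dots> \<le> L * (B / 2 ^ n * E (time_scale r p))"
        using Suc.IH[OF b] \<open>1 \<le> L\<close> by (intro mult_left_mono) auto
      finally show "norm (Y (picard (Suc n) (time_scale r p)) - Y (picard n (time_scale r p)))
        \<le> L * (B / 2 ^ n) * exp (l * (r * \<bar>fst p\<bar>))"
        using r by (simp add: E_scale)
    next
      show "continuous_on {0..1} (\<lambda>r. Y (picard (Suc n) (time_scale r p)) - Y (picard n (time_scale r p)))"
        by (intro continuous_intros)
    qed (use \<open>0 < l\<close> \<open>1 \<le> L\<close> B_nonneg in auto)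
    also have "L * (B / 2 ^ n) / l \<le> B / 2 ^ Suc n"
      using \<open>1 \<le> L\<close> B_nonneg by (simp add: l_def field_simps)
    also have "fst p *\<^sub>R integral {0..1} (\<lambda>r. Y (picard (Suc n) (time_scale r p)) - Y (picard n (time_scale r p)))
        = picard (Suc (Suc n)) p - picard (Suc n) p"
      using step_diff[OF picard_continuous picard_continuous, of "Suc n" p n] by (simp only: picard.simps)
    finally show ?case using E_ge_1[of p] by (simp add: mult_right_mono)
  qed
  \<comment> \<open>The difference of the derivatives contains a product of two weighted quantities.
    Bounding one of them by the constant \<open>M'\<close> on the box leaves a single weight, which
    the next integration can handle.\<close>
  define M' where "M' = M * exp (l * R)"
  \<comment> \<open>The summand \<open>2 * M'\<close> settles the base case, where two derivatives
    bounded by \<open>M'\<close> are subtracted. The others make room for the source terms, in the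
    inequality \<open>L * B + (B * M' + D) / 8 \<le> D / 2\<close>.\<close>
  define D where "D = 2 * M' + 4 * (L * B) + B * M'"
  have M'_bound: "M * E p \<le> M'" if "p \<in> box0 R" for p
    using that \<open>0 < l\<close> B_nonneg by (auto simp: M'_def M_def E_def mem_Times_iff intro!: mult_left_mono)
  have "0 \<le> M'" "0 \<le> D"
    using B_nonneg \<open>1 \<le> L\<close> by (auto simp: M'_def D_def M_def)
  have nonneg: "0 \<le> L * B" "0 \<le> B * M'"
    using \<open>1 \<le> L\<close> B_nonneg \<open>0 \<le> M'\<close> by simp_all
  have D_ge: "2 * M' \<le> D" "L * B + (B * M' + D) / 8 \<le> D / 2"
    using nonneg \<open>0 \<le> M'\<close> by (auto simp: D_def field_simps)
  have d'_bound: "norm (picard' (Suc n) p - picard' n p) \<le> D / 2 ^ n * E p" if "p \<in> box0 R" for n p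
    using that
  proof (induction n arbitrary: p)
    case 0
    have "norm (picard' (Suc 0) p - picard' 0 p) \<le> M * E p + M * E p"
      by (intro norm_triangle_le_diff add_mono p'_bound 0)
    also have "\<dots> \<le> D * 1"
      using M'_bound[OF 0] D_ge(1) by simp
    also have "\<dots> \<le> D * E p"
      using \<open>0 \<le> D\<close> E_ge_1 by (intro mult_left_mono)
    finally show ?case by simp
  next
    case (Suc n)
    let ?G = "\<lambda>n r. Y' (picard n (time_scale r p)) o\<^sub>L picard' n (time_scale r p) o\<^sub>L time_scale r"
    let ?H = "\<lambda>n r. Y (picard n (time_scale r p))"
    have dY: "norm (Y (picard (Suc n) (time_scale r p)) - Y (picard n (time_scale r p))) \<le> L * (B / 2 ^ n * E (time_scale r p))"
      and dY': "norm (Y' (picard (Suc n) (time_scale r p)) - Y' (picard n (time_scale r p))) \<le> L * (B / 2 ^ n * E (time_scale r p))"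
      if r: "0 \<le> r" "r \<le> 1" for r
    proof -
      note b = scale_box[OF Suc.prems r]
      have *: "L * norm (picard (Suc n) (time_scale r p) - picard n (time_scale r p)) \<le> L * (B / 2 ^ n * E (time_scale r p))"
        using d_bound[OF b] \<open>1 \<le> L\<close> by (intro mult_left_mono) auto
      show "norm (Y (picard (Suc n) (time_scale r p)) - Y (picard n (time_scale r p))) \<le> L * (B / 2 ^ n * E (time_scale r p))"
        by (rule order_trans[OF lipY[OF inS[OF b] inS[OF b]] *])
      show "norm (Y' (picard (Suc n) (time_scale r p)) - Y' (picard n (time_scale r p))) \<le> L * (B / 2 ^ n * E (time_scale r p))"
        by (rule order_trans[OF lipY'[OF inS[OF b] inS[OF b]] *])
    qed
    \<comment> \<open>This term lacks the factor \<open>fst p\<close>, so the integration gains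
      nothing; it decays because the iterates themselves already converge geometrically.\<close>
    have 1: "norm (blinfun_scaleR_left (integral {0..1} (\<lambda>r. ?H (Suc n) r - ?H n r)) o\<^sub>L
       (fst_blinfun :: (real \<times> 'a) \<Rightarrow>\<^sub>L real)) \<le> L * (B / 2 ^ n * E p)"
      proof (intro norm_rank_one_le norm_integral_le_bound continuous_intros)
      fix r :: real assume r: "0 \<le> r" "r \<le> 1"
      have "L * (B / 2 ^ n * E (time_scale r p)) \<le> L * (B / 2 ^ n * E p)"
        using \<open>1 \<le> L\<close> B_nonneg E_scale_le[OF r] by (intro mult_left_mono) auto
      then show "norm (?H (Suc n) r - ?H n r) \<le> L * (B / 2 ^ n * E p)"
        using dY[OF r] by linarith
    qed
    have 2: "norm (fst p *\<^sub>R integral {0..1} (\<lambda>r. ?G (Suc n) r - ?G n r)) \<le> (L * (B / 2 ^ n) * M' + L * (D / 2 ^ n)) / l * E p"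
      unfolding E_def
    proof (rule norm_scaled_integral_le_exp)
      fix r :: real assume r: "0 \<le> r" "r \<le> 1"
      note b = scale_box[OF Suc.prems r]
      let ?q = "time_scale r p"
      \<comment> \<open>The difference of products is split so that one part contains only the known
        difference of \<open>Y'\<close> and the other the difference under induction.\<close>
      have "?G (Suc n) r - ?G n r =
        (((Y' (picard (Suc n) ?q) - Y' (picard n ?q)) o\<^sub>L picard' (Suc n) ?q)
          + (Y' (picard n ?q) o\<^sub>L (picard' (Suc n) ?q - picard' n ?q))) o\<^sub>L time_scale r"
        by (rule blinfun_eqI) (simp add: blinfun.bilinear_simps)
      also have "norm \<dots> \<le> ((L * (B / 2 ^ n * E ?q)) * M' + L * (D / 2 ^ n * E ?q)) * 1"
        proof (rule order_trans[OF norm_blinfun_compose mult_mono[OF order_trans[OF norm_triangle_ineq add_mono] norm_time_scale_le[OF r]]])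
        show "norm ((Y' (picard (Suc n) ?q) - Y' (picard n ?q)) o\<^sub>L picard' (Suc n) ?q) \<le> L * (B / 2 ^ n * E ?q) * M'"
          using dY'[OF r] order_trans[OF p'_bound[OF b, of "Suc n"] M'_bound[OF b]] \<open>1 \<le> L\<close> B_nonneg E_ge_1[of ?q]
          by (intro order_trans[OF norm_blinfun_compose mult_mono]) auto
        show "norm (Y' (picard n ?q) o\<^sub>L (picard' (Suc n) ?q - picard' n ?q)) \<le> L * (D / 2 ^ n * E ?q)"
          using LY'[OF inS[OF b]] Suc.IH[OF b] \<open>1 \<le> L\<close>
          by (intro order_trans[OF norm_blinfun_compose mult_mono]) auto
      qed (use \<open>1 \<le> L\<close> B_nonneg \<open>0 \<le> M'\<close> \<open>0 \<le> D\<close> E_ge_1[of ?q] in auto)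
      finally show "norm (?G (Suc n) r - ?G n r) \<le> (L * (B / 2 ^ n) * M' + L * (D / 2 ^ n)) * exp (l * (r * \<bar>fst p\<bar>))"
        using r by (simp add: E_scale algebra_simps)
    next
      show "continuous_on {0..1} (\<lambda>r. ?G (Suc n) r - ?G n r)"
        by (intro continuous_intros)
    qed (use \<open>0 < l\<close> \<open>1 \<le> L\<close> \<open>0 \<le> D\<close> \<open>0 \<le> M'\<close> B_nonneg in auto)
    have "picard' (Suc (Suc n)) p - picard' (Suc n) p =
      (blinfun_scaleR_left (integral {0..1} (\<lambda>r. ?H (Suc n) r - ?H n r)) o\<^sub>L fst_blinfun)
       + fst p *\<^sub>R integral {0..1} (\<lambda>r. ?G (Suc n) r - ?G n r)"
      using step'_diff[OF picard_continuous picard_C1(2) picard_continuous picard_C1(2), of "Suc n" "Suc n" p n n]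
      by (simp only: picard.simps picard'.simps)
    also have "norm \<dots> \<le> L * (B / 2 ^ n * E p) + (L * (B / 2 ^ n) * M' + L * (D / 2 ^ n)) / l * E p"
      by (intro norm_triangle_mono 1 2)
    also have "\<dots> = (L * B + (B * M' + D) / 8) / 2 ^ n * E p"
      using \<open>1 \<le> L\<close> by (simp add: l_def field_simps)
    also have "\<dots> \<le> (D / 2) / 2 ^ n * E p"
      using E_ge_1[of p] D_ge(2) by (intro mult_right_mono divide_right_mono) simp_all
    finally show ?case by simp
  qed
  have "norm (picard (Suc n) p - picard n p) \<le> ((B + D) * exp (l * R)) / 2 ^ n \<and>
     norm (picard' (Suc n) p - picard' n p) \<le> ((B + D) * exp (l * R)) / 2 ^ n" if "p \<in> box0 R" for n p
  proof -
    have "E p \<le> exp (l * R)"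
      using that \<open>0 < l\<close> by (auto simp: E_def mem_Times_iff)
    then have "B / 2 ^ n * E p \<le> (B + D) / 2 ^ n * exp (l * R)" "D / 2 ^ n * E p \<le> (B + D) / 2 ^ n * exp (l * R)"
      using B_nonneg \<open>0 \<le> D\<close> E_ge_1[of p] by (intro mult_mono divide_right_mono; simp)+
    then show ?thesis
      using d_bound[OF that, of n] d'_bound[OF that, of n] by simp
  qed
  then show ?thesis by blast
qed

end

text \<open>On a box with \<open>p\<close> in its interior, which is convex, uniform convergence of
  the derivatives yields some differentiable limit; uniqueness of pointwise limits identifies it
  with \<open>g\<close>.\<close>

lemma uniform_limit_has_derivative:
  fixes f :: "nat \<Rightarrow> real \<times> 'a::euclidean_space \<Rightarrow> 'b::banach"
  assumes f: "\<And>n p. (f n has_derivative blinfun_apply (f' n p)) (at p)"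
    and f_lim: "\<And>R. uniform_limit (box0 R) f g sequentially"
    and f'_lim: "\<And>R. uniform_limit (box0 R) f' g' sequentially"
  shows "(g has_derivative blinfun_apply (g' p)) (at p)"
proof -
  let ?S = "box0 (norm p + 1) :: (real \<times> 'a) set"
  have p: "p \<in> ?S"
    using in_interior_box0 interior_subset by blast
  have "\<exists>g. \<forall>x\<in>?S. (\<lambda>n. f n x) \<longlonglongrightarrow> g x \<and> (g has_derivative blinfun_apply (g' x)) (at x within ?S)"
  proof (rule has_derivative_sequence)
    show "convex ?S" by (intro convex_Times convex_cball)
    show "(f n has_derivative blinfun_apply (f' n x)) (at x within ?S)" for n x
      by (rule has_derivative_at_withinI[OF f])
    show "\<forall>\<^sub>F n in sequentially. \<forall>x\<in>?S. \<forall>h. norm (f' n x h - g' x h) \<le> e * norm h" if "0 < e" for e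
      using uniform_limitD[OF f'_lim[of "norm p + 1"] that]
    proof eventually_elim
      case (elim n)
      then have "norm ((f' n x - g' x) h) \<le> e * norm h" if "x \<in> ?S" for x h
        using that by (intro order_trans[OF norm_blinfun mult_right_mono]) (force simp: dist_norm)+
      then show ?case by (simp add: blinfun.diff_left)
    qed
  qed (rule p, rule tendsto_uniform_limitI[OF f_lim p])
  then obtain k where k: "\<And>x. x \<in> ?S \<Longrightarrow> (\<lambda>n. f n x) \<longlonglongrightarrow> k x"
    "\<And>x. x \<in> ?S \<Longrightarrow> (k has_derivative blinfun_apply (g' x)) (at x within ?S)"
    by blast
  have "k x = g x" if "x \<in> ?S" for x
    by (rule LIMSEQ_unique[OF k(1)[OF that] tendsto_uniform_limitI[OF f_lim that]])
  then have "(g has_derivative blinfun_apply (g' p)) (at p within ?S)"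
    using has_derivative_transform[OF p _ k(2)[OF p], of g] by simp
  then show ?thesis
    using at_within_interior[OF in_interior_box0] by metis
qed

lemma uniform_limit_continuous:
  fixes f :: "nat \<Rightarrow> real \<times> 'a::euclidean_space \<Rightarrow> 'b::banach"
  assumes f: "\<And>n. continuous_on UNIV (f n)"
    and f_lim: "\<And>R. uniform_limit (box0 R) f g sequentially"
  shows "continuous_on UNIV g"
proof (rule continuous_at_imp_continuous_on, rule ballI)
  fix p :: "real \<times> 'a"
  have "continuous_on (box0 (norm p + 1)) g"
    by (rule uniform_limit_theorem[OF _ f_lim])
      (auto intro: always_eventually continuous_on_subset[OF f])
  then show "isCont g p"
    by (rule continuous_on_interior[OF _ in_interior_box0])
qed

section \<open>The flow as limit of the Picard iterates\<close>

context bounded_field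
begin

lemma fixed_point_C1:
  obtains \<psi> \<psi>' where
    "\<And>p. (\<psi> has_derivative blinfun_apply (\<psi>' p)) (at p)"
    "continuous_on UNIV \<psi>'"
    "step \<psi> = \<psi>"
proof -
  obtain \<psi> where \<psi>: "\<And>R. uniform_limit (box0 R) picard \<psi> sequentially"
    using uniform_limit_of_geometric_steps[of box0 picard] picard_Cauchy by blast
  obtain \<psi>' where \<psi>': "\<And>R. uniform_limit (box0 R) picard' \<psi>' sequentially"
    using uniform_limit_of_geometric_steps[of box0 picard'] picard_Cauchy by blast
  have lim: "(\<lambda>n. picard n p) \<longlonglongrightarrow> \<psi> p" for p
    using in_interior_box0 interior_subset by (blast intro: tendsto_uniform_limitI[OF \<psi>])
  have "step \<psi> p = \<psi> p" for p
  proof (rule LIMSEQ_unique)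
    \<comment> \<open>Pointwise convergence suffices here, since the constant \<open>B\<close>
      dominates.\<close>
    have "(\<lambda>n. integral {0..1} (\<lambda>r. Y (picard n (time_scale r p)))) \<longlonglongrightarrow>
        integral {0..1} (\<lambda>r. Y (\<psi> (time_scale r p)))"
    proof (rule dominated_convergence(2))
      show "(\<lambda>r. Y (picard n (time_scale r p))) integrable_on {0..1}" for n
        by (intro integrable_continuous_interval continuous_intros)
      show "(\<lambda>n. Y (picard n (time_scale r p))) \<longlonglongrightarrow> Y (\<psi> (time_scale r p))" for r
        using Y_continuous by (intro isCont_tendsto_compose[OF _ lim]) (simp add: continuous_on_eq_continuous_at)
      show "(\<lambda>r::real. B) integrable_on {0..1}"
        by (intro integrable_continuous_interval continuous_intros)
    qed (rule Y_bound)
    then have "(\<lambda>n. step (picard n) p) \<longlonglongrightarrow> step \<psi> p"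
      unfolding step_def by (intro tendsto_intros)
    then show "(\<lambda>n. picard (Suc n) p) \<longlonglongrightarrow> step \<psi> p"
      by simp
    show "(\<lambda>n. picard (Suc n) p) \<longlonglongrightarrow> \<psi> p"
      by (rule LIMSEQ_Suc[OF lim])
  qed
  then show ?thesis
    by (intro that[OF uniform_limit_has_derivative[OF picard_C1(1) \<psi> \<psi>']
        uniform_limit_continuous[OF picard_C1(2) \<psi>']] ext)
qed

text \<open>The hypothesis \<open>eq\<close> is the rescaled integral form of D' = A D, D(0) = 0.
  Inserting a weighted bound for \<open>D\<close> into it halves the bound, so iteration forces
  \<open>D\<close> to vanish; this replaces a Gronwall argument.\<close>

lemma linear_uniqueness:
  fixes A :: "real \<Rightarrow> 'a \<Rightarrow>\<^sub>L 'a" and D :: "real \<Rightarrow> 'a"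
  assumes A: "continuous_on UNIV A" and D: "continuous_on UNIV D"
    and eq: "\<And>t. D t = t *\<^sub>R integral {0..1} (\<lambda>r. A (r * t) (D (r * t)))"
  shows "D t = 0"
proof -
  obtain L where "0 \<le> L" and L: "\<And>s. norm s \<le> \<bar>t\<bar> \<Longrightarrow> norm (A s) \<le> L"
    using continuous_bounded_on_cball[OF A] by blast
  obtain M where "0 \<le> M" and M: "\<And>s. norm s \<le> \<bar>t\<bar> \<Longrightarrow> norm (D s) \<le> M"
    using continuous_bounded_on_cball[OF D] by blast
  \<comment> \<open>This gives L / l \<le> 1/2, and the added 1 keeps \<open>l\<close> positive when
    \<open>L\<close> is 0.\<close>
  define l where "l = 2 * (L + 1)"
  have "0 < l" using \<open>0 \<le> L\<close> by (simp add: l_def)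
  note [continuous_intros] =
    continuous_on_compose2[OF A _ subset_UNIV] continuous_on_compose2[OF D _ subset_UNIV]
  have bound: "norm (D s) \<le> M / 2 ^ n * exp (l * \<bar>s\<bar>)" if "\<bar>s\<bar> \<le> \<bar>t\<bar>" for s n
    using that
  proof (induction n arbitrary: s)
    case 0
    have "M * 1 \<le> M * exp (l * \<bar>s\<bar>)"
      using \<open>0 \<le> M\<close> \<open>0 < l\<close> by (intro mult_left_mono) auto
    then show ?case using M[of s] 0 by simp
  next
    case (Suc n)
    have "norm (D s) = norm (s *\<^sub>R integral {0..1} (\<lambda>r. A (r * s) (D (r * s))))"
      using eq[of s] by simp
    also have "\<dots> \<le> L * (M / 2 ^ n) / l * exp (l * \<bar>s\<bar>)"
    proof (rule norm_scaled_integral_le_exp)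
      fix r :: real assume r: "0 \<le> r" "r \<le> 1"
      then have rs: "\<bar>r * s\<bar> \<le> \<bar>t\<bar>"
        using Suc.prems mult_left_le_one_le[of "\<bar>s\<bar>" r] by (simp add: abs_mult)
      have "norm (A (r * s) (D (r * s))) \<le> L * (M / 2 ^ n * exp (l * \<bar>r * s\<bar>))"
        using L rs Suc.IH[OF rs] \<open>0 \<le> L\<close>
        by (intro order_trans[OF norm_blinfun mult_mono]) auto
      then show "norm (A (r * s) (D (r * s))) \<le> L * (M / 2 ^ n) * exp (l * (r * \<bar>s\<bar>))"
        using r by (simp add: abs_mult)
    qed (use \<open>0 < l\<close> \<open>0 \<le> L\<close> \<open>0 \<le> M\<close> in \<open>auto intro!: continuous_intros\<close>)
    also have "\<dots> \<le> M / 2 ^ Suc n * exp (l * \<bar>s\<bar>)"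
    proof (rule mult_right_mono)
      have "L / l * (M / 2 ^ n) \<le> 1 / 2 * (M / 2 ^ n)"
        using \<open>0 \<le> L\<close> \<open>0 \<le> M\<close> by (intro mult_right_mono) (auto simp: l_def field_simps)
      then show "L * (M / 2 ^ n) / l \<le> M / 2 ^ Suc n"
        by (simp add: mult.commute)
    qed simp
    finally show ?case .
  qed
  have "(\<lambda>n. M * exp (l * \<bar>t\<bar>) * (1 / 2) ^ n) \<longlonglongrightarrow> M * exp (l * \<bar>t\<bar>) * 0"
    by (intro tendsto_intros LIMSEQ_power_zero) simp
  then have "norm (D t) \<le> M * exp (l * \<bar>t\<bar>) * 0"
    by (rule LIMSEQ_le_const) (use bound[of t] in \<open>auto simp: power_divide\<close>)
  then show ?thesis by simp
qed

text \<open>The last property is the group law \<psi>(t, \<psi>(s, x)) = \<psi>(t + s, x)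
  differentiated at s = 0; it is derived from the linearised equation rather than from the group
  law.\<close>

theorem flow_exists:
  obtains \<psi> :: "real \<times> 'a \<Rightarrow> 'a" and \<psi>' where
    "\<And>p. (\<psi> has_derivative blinfun_apply (\<psi>' p)) (at p)"
    "continuous_on UNIV \<psi>'"
    "\<And>x. \<psi> (0, x) = x"
    "\<And>t x. \<psi>' (t, x) (1, 0) = Y (\<psi> (t, x))"
    "\<And>t x. \<psi>' (t, x) (0, Y x) = Y (\<psi> (t, x))"
proof -
  obtain \<psi> \<psi>' where d: "\<And>p. (\<psi> has_derivative blinfun_apply (\<psi>' p)) (at p)"
    and c': "continuous_on UNIV \<psi>'" and fp: "step \<psi> = \<psi>"
    using fixed_point_C1 by blast
  have c: "continuous_on UNIV \<psi>"
    using d by (meson continuous_at_imp_continuous_on has_derivative_continuous)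
  note [continuous_intros] =
    continuous_on_compose2[OF c _ subset_UNIV] continuous_on_compose2[OF c' _ subset_UNIV]
  \<comment> \<open>Differentiating the fixed point equation and using uniqueness of derivatives
    gives the linearised integral equation for \<open>\<psi>'\<close>.\<close>
  have d_eq: "\<psi>' p = step' \<psi> \<psi>' p" for p
    using has_derivative_unique[OF d step_C1(1)[OF d c', unfolded fp], of p]
    by (simp add: blinfun_apply_inject)
  have zero: "\<psi> (0, x) = x" for x
    using fun_cong[OF fp, of "(0, x)"] by (simp add: step_def)
  define G where "G p r = Y' (\<psi> (time_scale r p)) o\<^sub>L \<psi>' (time_scale r p) o\<^sub>L time_scale r" for p r
  have G_c: "continuous_on {0..1} (G p)" for p
    unfolding G_def by (intro continuous_intros)
  have int_apply: "integral {0..1} (G p) v = integral {0..1} (\<lambda>r. G p r v)" for p v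
    by (rule blinfun_apply_integral) (intro integrable_continuous_interval G_c)
  have curve: "((\<lambda>r. Y (\<psi> (time_scale r p))) has_vector_derivative
      Y' (\<psi> (time_scale r p)) (\<psi>' (time_scale r p) (fst p, 0))) (at r within S)" for r p S
  proof -
    have "((\<lambda>r. (r * fst p, snd p)) has_derivative (\<lambda>h. (h * fst p, 0))) (at r within S)"
      by (auto intro!: derivative_eq_intros)
    from has_derivative_compose[OF has_derivative_compose[OF this d] Y_deriv]
    show ?thesis
      unfolding has_vector_derivative_def time_scale_apply
      by (rule has_derivative_eq_rhs)
        (simp add: fun_eq_iff flip: blinfun.scaleR_right)
  qed
  \<comment> \<open>differentiating the fixed point equation in \<open>t\<close> gives \<open>\<integral> d/dr (r Y(\<psi>(r t, x))) dr\<close>\<close>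
  have time: "\<psi>' (t, x) (1, 0) = Y (\<psi> (t, x))" for t x
  proof -
    let ?p = "(t, x)"
    have "((\<lambda>r. r *\<^sub>R Y (\<psi> (time_scale r ?p))) has_vector_derivative
        Y (\<psi> (time_scale r ?p)) + t *\<^sub>R G ?p r (1, 0)) (at r within {0..1})" for r
    proof -
      have "t *\<^sub>R G ?p r (1, 0) = r *\<^sub>R Y' (\<psi> (time_scale r ?p)) (\<psi>' (time_scale r ?p) (t, 0))"
        by (simp add: G_def time_scale_apply mult.commute flip: blinfun.scaleR_right)
      then show ?thesis
        using has_vector_derivative_scaleR[OF DERIV_ident curve[of ?p r "{0..1}"]] by (simp add: add.commute)
    qed
    then have "((\<lambda>r. Y (\<psi> (time_scale r ?p)) + t *\<^sub>R G ?p r (1, 0)) has_integral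
        1 *\<^sub>R Y (\<psi> (time_scale 1 ?p)) - 0 *\<^sub>R Y (\<psi> (time_scale 0 ?p))) {0..1}"
      by (intro fundamental_theorem_of_calculus) simp_all
    then have "integral {0..1} (\<lambda>r. Y (\<psi> (time_scale r ?p)) + t *\<^sub>R G ?p r (1, 0)) = Y (\<psi> ?p)"
      by (simp add: integral_unique time_scale_apply)
    moreover have "integral {0..1} (\<lambda>r. Y (\<psi> (time_scale r ?p)) + t *\<^sub>R G ?p r (1, 0))
      = integral {0..1} (\<lambda>r. Y (\<psi> (time_scale r ?p))) + t *\<^sub>R integral {0..1} (\<lambda>r. G ?p r (1, 0))"
      using G_c by (subst integral_add) (auto intro!: integrable_continuous_interval continuous_intros)
    ultimately show ?thesis
      by (subst d_eq) (simp add: step'_def blinfun.bilinear_simps int_apply flip: G_def)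
  qed
  \<comment> \<open>both sides solve the linearised equation with initial value \<open>Y x\<close>\<close>
  have space: "\<psi>' (t, x) (0, Y x) = Y (\<psi> (t, x))" for t x
  proof -
    define D where "D s = \<psi>' (s, x) (0, Y x) - Y (\<psi> (s, x))" for s
    have "D t = 0"
    proof (rule linear_uniqueness)
      show "continuous_on UNIV (\<lambda>s. Y' (\<psi> (s, x)))" "continuous_on UNIV D"
        unfolding D_def by (intro continuous_intros)+
      show "D s = s *\<^sub>R integral {0..1} (\<lambda>r. Y' (\<psi> (r * s, x)) (D (r * s)))" for s
      proof -
        let ?p = "(s, x)"
        have "((\<lambda>r. s *\<^sub>R Y' (\<psi> (r * s, x)) (Y (\<psi> (r * s, x)))) has_integral
            Y (\<psi> (time_scale 1 ?p)) - Y (\<psi> (time_scale 0 ?p))) {0..1}"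
        proof (rule fundamental_theorem_of_calculus)
          fix r :: real
          have "s *\<^sub>R Y' (\<psi> (r * s, x)) (Y (\<psi> (r * s, x))) = Y' (\<psi> (r * s, x)) (\<psi>' (r * s, x) (s, 0))"
            by (simp add: time[symmetric] flip: blinfun.scaleR_right)
          then show "((\<lambda>r. Y (\<psi> (time_scale r ?p))) has_vector_derivative
              s *\<^sub>R Y' (\<psi> (r * s, x)) (Y (\<psi> (r * s, x)))) (at r within {0..1})"
            using curve[of ?p r "{0..1}"] by (simp add: time_scale_apply)
        qed simp
        then have Y_int: "Y (\<psi> (s, x)) = Y x + s *\<^sub>R integral {0..1} (\<lambda>r. Y' (\<psi> (r * s, x)) (Y (\<psi> (r * s, x))))"
          by (auto simp: time_scale_apply zero dest!: integral_unique)
        have "\<psi>' ?p (0, Y x) = Y x + s *\<^sub>R integral {0..1} (\<lambda>r. Y' (\<psi> (r * s, x)) (\<psi>' (r * s, x) (0, Y x)))"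
          using int_apply[of ?p "(0, Y x)"]
          by (subst d_eq) (simp add: step'_def blinfun.bilinear_simps time_scale_apply G_def[abs_def])
        then show ?thesis
          unfolding D_def Y_int blinfun.diff_right
          by (subst integral_continuous_diff[symmetric])
            (auto simp: scaleR_diff_right intro!: continuous_intros)
      qed
    qed
    then show ?thesis by (simp add: D_def)
  qed
  show ?thesis
    by (rule that[of \<psi> \<psi>', OF d c' zero time space])
qed

end

section \<open>Transport equation and potentials\<close>

lemma continuous_on_blinfun_inner [continuous_intros]:
  "continuous_on S f \<Longrightarrow> continuous_on S (\<lambda>x. blinfun_inner_left (f x))"
  "continuous_on S f \<Longrightarrow> continuous_on S (\<lambda>x. blinfun_inner_right (f x))"
  by (rule bounded_linear.continuous_on[OF bounded_linear_blinfun_inner_left]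
      bounded_linear.continuous_on[OF bounded_linear_blinfun_inner_right], assumption)+

lemma continuous_on_slice:
  assumes "continuous_on UNIV (\<lambda>(x, r). g r x)"
  shows "continuous_on S (\<lambda>r. g r x)"
  using continuous_on_compose2[OF assms continuous_on_Pair[OF continuous_on_const continuous_on_id] subset_UNIV, of S x]
  by simp

text \<open>The first form evaluates under the integral sign, ready for the fundamental theorem of
  calculus; the second keeps a bounded linear map, whose continuity is the third claim.\<close>

lemma has_derivative_integral_01:
  fixes g :: "real \<Rightarrow> 'a::euclidean_space \<Rightarrow> 'b::banach"
  assumes g: "\<And>r x. (g r has_derivative blinfun_apply (g' r x)) (at x)"
    and gc: "\<And>x. continuous_on {0..1} (\<lambda>r. g r x)"
    and g'c: "continuous_on UNIV (\<lambda>(x, r). g' r x)"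
  shows "((\<lambda>x. integral {0..1} (\<lambda>r. g r x)) has_derivative
      (\<lambda>v. integral {0..1} (\<lambda>r. g' r x v))) (at x)"
    and "((\<lambda>x. integral {0..1} (\<lambda>r. g r x)) has_derivative
      blinfun_apply (integral {0..1} (\<lambda>r. g' r x))) (at x)"
    and "continuous_on UNIV (\<lambda>x. integral {0..1} (\<lambda>r. g' r x))"
proof -
  show *: "((\<lambda>x. integral {0..1} (\<lambda>r. g r x)) has_derivative
      blinfun_apply (integral {0..1} (\<lambda>r. g' r x))) (at x)"
    unfolding cbox_interval[symmetric]
  proof (rule leibniz_rule[where U=UNIV])
    show "(\<lambda>r. g r x) integrable_on cbox 0 1" for x
      using gc by (simp add: integrable_continuous_interval)
  qed (use g g'c in \<open>auto intro: continuous_on_subset\<close>)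
  show "continuous_on UNIV (\<lambda>x. integral {0..1} (\<lambda>r. g' r x))"
    unfolding cbox_interval[symmetric]
    by (intro integral_continuous_on_param continuous_on_subset[OF g'c] subset_UNIV)
  have "continuous_on {0..1} (\<lambda>r. g' r x)"
    by (rule continuous_on_slice[OF g'c])
  then have "blinfun_apply (integral {0..1} (\<lambda>r. g' r x)) = (\<lambda>v. integral {0..1} (\<lambda>r. g' r x v))"
    by (intro ext blinfun_apply_integral integrable_continuous_interval)
  then show "((\<lambda>x. integral {0..1} (\<lambda>r. g r x)) has_derivative
      (\<lambda>v. integral {0..1} (\<lambda>r. g' r x v))) (at x)"
    using * by metis
qed

text \<open>The solution vanishing on the level set \<open>u = 0\<close>: as \<open>u\<close> grows at unit speed along the flow,
  following it backwards for time \<open>u x\<close> leads from \<open>x\<close> to that set, and \<open>w x\<close> is the integral of \<open>h\<close>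
  along this arc.\<close>

lemma (in bounded_field) transport_solvable:
  fixes u h :: "'a \<Rightarrow> real"
  assumes u: "\<And>x. (u has_derivative blinfun_apply (u' x)) (at x)"
    and u': "continuous_on UNIV u'" and uY: "\<And>x. u' x (Y x) = 1"
    and h: "\<And>x. (h has_derivative blinfun_apply (h' x)) (at x)"
    and h': "continuous_on UNIV h'"
  obtains w :: "'a \<Rightarrow> real" and w' where
    "\<And>x. (w has_derivative blinfun_apply (w' x)) (at x)" "continuous_on UNIV w'"
    "\<And>x. w' x (Y x) = h x"
proof -
  obtain \<psi> :: "real \<times> 'a \<Rightarrow> 'a" and \<psi>'
    where \<psi>: "\<And>p. (\<psi> has_derivative blinfun_apply (\<psi>' p)) (at p)"
      and \<psi>': "continuous_on UNIV \<psi>'" and zero: "\<And>x. \<psi> (0, x) = x"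
      and time: "\<And>t x. \<psi>' (t, x) (1, 0) = Y (\<psi> (t, x))"
      and space: "\<And>t x. \<psi>' (t, x) (0, Y x) = Y (\<psi> (t, x))"
    using flow_exists by blast
  have cont: "continuous_on UNIV u" "continuous_on UNIV h" "continuous_on UNIV \<psi>"
    using u h \<psi> by (meson continuous_at_imp_continuous_on has_derivative_continuous)+
  note [continuous_intros] =
    cont[THEN continuous_on_compose2[OF _ _ subset_UNIV]]
    u'[THEN continuous_on_compose2[OF _ _ subset_UNIV]]
    h'[THEN continuous_on_compose2[OF _ _ subset_UNIV]]
    \<psi>'[THEN continuous_on_compose2[OF _ _ subset_UNIV]]
  define P1 where "P1 = Blinfun (\<lambda>t::real. (t, 0::'a))"
  define P2 where "P2 = Blinfun (\<lambda>v::'a. (0::real, v))"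
  have P: "P1 t = (t, 0)" "P2 v = (0, v)" for t v
    unfolding P1_def P2_def by (intro fun_cong[OF bounded_linear_Blinfun_apply] bounded_linear_intros)+
  \<comment> \<open>As \<open>r\<close> runs from 0 to 1, \<open>\<psi> (q r x)\<close> runs
    backwards along the trajectory, starting at \<open>x\<close>, for total time
    \<open>u x\<close>.\<close>
  define q where "q r x = (- (u x * r), x)" for r and x :: 'a
  define q' where "q' r x = (- r) *\<^sub>R (P1 o\<^sub>L u' x) + P2" for r x
  have q'_apply: "q' r x v = (- (u' x v * r), v)" for r x v
    by (simp add: q'_def blinfun.bilinear_simps P)
  have q: "(q r has_derivative blinfun_apply (q' r x)) (at x)" for r x
    unfolding q_def q'_apply[abs_def] by (auto intro!: derivative_eq_intros u)
  define g' where "g' r x = h' (\<psi> (q r x)) o\<^sub>L \<psi>' (q r x) o\<^sub>L q' r x" for r x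
  have g: "((\<lambda>x. h (\<psi> (q r x))) has_derivative blinfun_apply (g' r x)) (at x)" for r x
    using has_derivative_compose[OF has_derivative_compose[OF q \<psi>] h]
    by (simp add: g'_def blinfun_compose.rep_eq o_def)
  have gc: "continuous_on {0..1} (\<lambda>r. h (\<psi> (q r x)))" for x
    unfolding q_def by (intro continuous_intros)
  have g'c: "continuous_on UNIV (\<lambda>(x, r). g' r x)"
    unfolding g'_def q_def q'_def by (auto simp: split_beta intro!: continuous_intros)
  note int = has_derivative_integral_01[OF g gc g'c]
  define I where "I x = integral {0..1} (\<lambda>r. h (\<psi> (q r x)))" for x
  define w where "w x = u x * I x" for x
  define w' where "w' x = u x *\<^sub>R integral {0..1} (\<lambda>r. g' r x) + I x *\<^sub>R u' x" for x
  have "(w has_derivative blinfun_apply (w' x)) (at x)" for x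
    unfolding w_def w'_def I_def
    by (rule has_derivative_eq_rhs[OF has_derivative_mult[OF u int(2)]])
      (simp add: fun_eq_iff blinfun.bilinear_simps)
  moreover have "continuous_on UNIV I"
    using int(2) unfolding I_def
    by (meson continuous_at_imp_continuous_on has_derivative_continuous)
  then have "continuous_on UNIV w'"
    unfolding w'_def using int(3) u' cont by (intro continuous_intros)
  moreover have "w' x (Y x) = h x" for x
  proof -
    let ?y = "\<lambda>r. \<psi> (q r x)"
    \<comment> \<open>As \<open>u\<close> grows at rate 1 along \<open>Y\<close>, moving
      \<open>x\<close> in direction \<open>Y x\<close> changes \<open>q r x\<close> by
      \<open>(- r, Y x)\<close>; under \<open>\<psi>'\<close> the space part yields \<open>Y\<close>
      and the time part \<open>- r\<close> times \<open>Y\<close> at the image point.\<close>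
    have "\<psi>' (q r x) (- r, Y x) = (1 - r) *\<^sub>R Y (?y r)" for r
    proof -
      have "(- r, Y x) = (- r) *\<^sub>R (1, 0) + (0, Y x)" by simp
      then show ?thesis
        unfolding q_def by (simp only: blinfun.bilinear_simps time space) (simp add: algebra_simps)
    qed
    then have g'_Y: "g' r x (Y x) = (1 - r) * h' (?y r) (Y (?y r))" for r
      by (simp add: g'_def q'_apply uY blinfun.bilinear_simps)
    \<comment> \<open>This function falls from \<open>h x\<close> at \<open>r = 0\<close> to 0 at
      \<open>r = 1\<close>. Its derivative is minus the integrand that the product rule for
      \<open>w = u I\<close> produces in direction \<open>Y x\<close>.\<close>
    have "((\<lambda>r. (1 - r) * h (?y r)) has_real_derivative
        - (h (?y r) + u x * g' r x (Y x))) (at r within {0..1})" for r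
    proof -
      have "((\<lambda>r. (- (u x * r), x)) has_derivative (\<lambda>t. (- (u x * t), 0))) (at r within {0..1})"
        by (auto intro!: derivative_eq_intros)
      from has_derivative_compose[OF has_derivative_compose[OF this \<psi>] h]
      have 1: "((\<lambda>r. h (?y r)) has_derivative (\<lambda>t. h' (?y r) (\<psi>' (q r x) (- (u x * t), 0)))) (at r within {0..1})"
        unfolding q_def .
      have "\<psi>' (q r x) (- (u x * t), 0) = (- (u x * t)) *\<^sub>R Y (?y r)" for t
      proof -
        have "(- (u x * t), 0) = (- (u x * t)) *\<^sub>R (1, 0::'a)" by simp
        then show ?thesis
          unfolding q_def by (simp only: blinfun.scaleR_right time)
      qed
      with 1 have "((\<lambda>r. h (?y r)) has_real_derivative - (u x * h' (?y r) (Y (?y r)))) (at r within {0..1})"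
        unfolding has_field_derivative_def
        by (elim has_derivative_eq_rhs) (simp add: fun_eq_iff blinfun.bilinear_simps)
      then show ?thesis
        unfolding g'_Y by (auto intro!: derivative_eq_intros simp: algebra_simps)
    qed
    then have "((\<lambda>r. - (h (?y r) + u x * g' r x (Y x))) has_integral (1 - 1) * h (?y 1) - (1 - 0) * h (?y 0)) {0..1}"
      by (intro fundamental_theorem_of_calculus)
        (simp_all add: has_real_derivative_iff_has_vector_derivative)
    then have "((\<lambda>r. h (?y r) + u x * g' r x (Y x)) has_integral h x) {0..1}"
      unfolding has_integral_neg_iff by (simp add: q_def zero)
    moreover have "((\<lambda>r. g' r x (Y x)) has_integral integral {0..1} (\<lambda>r. g' r x) (Y x)) {0..1}"
      using has_integral_linear[OF integrable_integral[OF integrable_continuous_interval[OF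
        continuous_on_slice[OF g'c]]] blinfun.bounded_linear_left]
      by (simp add: o_def)
    from has_integral_add[OF integrable_integral[OF integrable_continuous_interval[OF gc]]
        has_integral_mult_right[OF this]]
    have "((\<lambda>r. h (?y r) + u x * g' r x (Y x)) has_integral
        I x + u x * integral {0..1} (\<lambda>r. g' r x) (Y x)) {0..1}"
      unfolding I_def .
    ultimately have "h x = I x + u x * integral {0..1} (\<lambda>r. g' r x) (Y x)"
      by (rule has_integral_unique)
    then show ?thesis
      by (simp add: w'_def blinfun.bilinear_simps uY)
  qed
  ultimately show ?thesis by (rule that)
qed

text \<open>Poincare lemma by integration along rays from the origin: the potential is the integral
  of F(r x) . x over r in [0, 1]. Symmetry turns the integrand of its derivative in direction v into
  d/dr of r F(r x) . v.\<close>

lemma potential_of_symmetric_derivative: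
  fixes F :: "'a::euclidean_space \<Rightarrow> 'a"
  assumes F: "\<And>x. (F has_derivative blinfun_apply (F' x)) (at x)"
    and F': "continuous_on UNIV F'" and sym: "\<And>x v w. F' x v \<bullet> w = F' x w \<bullet> v"
  obtains \<phi> where "\<And>x. (\<phi> has_derivative (\<lambda>v. F x \<bullet> v)) (at x)"
proof -
  have Fc: "continuous_on UNIV F"
    using F by (meson continuous_at_imp_continuous_on has_derivative_continuous)
  note [continuous_intros] =
    continuous_on_compose2[OF Fc _ subset_UNIV] continuous_on_compose2[OF F' _ subset_UNIV]
  define g' where "g' r x = r *\<^sub>R (blinfun_inner_left x o\<^sub>L F' (r *\<^sub>R x)) + blinfun_inner_right (F (r *\<^sub>R x))"
    for r x
  have g'_apply: "g' r x v = r * (F' (r *\<^sub>R x) v \<bullet> x) + F (r *\<^sub>R x) \<bullet> v" for r x v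
    by (simp add: g'_def blinfun.bilinear_simps)
  have "((\<lambda>x. r *\<^sub>R x) has_derivative (\<lambda>v. r *\<^sub>R v)) (at x)" for r and x :: 'a
    by (auto intro!: derivative_eq_intros)
  from has_derivative_compose[OF this F]
  have "((\<lambda>x. F (r *\<^sub>R x) \<bullet> x) has_derivative blinfun_apply (g' r x)) (at x)" for r x
    by (rule has_derivative_eq_rhs[OF has_derivative_inner[OF _ has_derivative_ident]])
      (simp add: fun_eq_iff g'_apply blinfun.bilinear_simps)
  moreover have "continuous_on {0..1} (\<lambda>r. F (r *\<^sub>R x) \<bullet> x)" for x
    by (intro continuous_intros)
  moreover have "continuous_on UNIV (\<lambda>(x, r). g' r x)"
    unfolding g'_def by (auto simp: split_beta intro!: continuous_intros)
  ultimately have d: "((\<lambda>x. integral {0..1} (\<lambda>r. F (r *\<^sub>R x) \<bullet> x)) has_derivative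
      (\<lambda>v. integral {0..1} (\<lambda>r. g' r x v))) (at x)" for x
    by (rule has_derivative_integral_01(1))
  have "integral {0..1} (\<lambda>r. g' r x v) = F x \<bullet> v" for x v
  proof -
    have "((\<lambda>r. r * (F (r *\<^sub>R x) \<bullet> v)) has_real_derivative g' r x v) (at r within {0..1})" for r
    proof -
      have "((\<lambda>r. r *\<^sub>R x) has_derivative (\<lambda>t. t *\<^sub>R x)) (at r within {0..1})"
        by (auto intro!: derivative_eq_intros)
      from has_derivative_inner_left[OF has_derivative_compose[OF this F], of v]
      have "((\<lambda>r. F (r *\<^sub>R x) \<bullet> v) has_real_derivative F' (r *\<^sub>R x) v \<bullet> x) (at r within {0..1})"
        unfolding has_field_derivative_def
        by (rule has_derivative_eq_rhs) (simp add: fun_eq_iff blinfun.bilinear_simps sym[of _ x])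
      then show ?thesis
        unfolding g'_apply by (auto intro!: derivative_eq_intros simp: algebra_simps)
    qed
    then have "((\<lambda>r. g' r x v) has_integral 1 * (F (1 *\<^sub>R x) \<bullet> v) - 0 * (F (0 *\<^sub>R x) \<bullet> v)) {0..1}"
      by (intro fundamental_theorem_of_calculus)
        (simp_all add: has_real_derivative_iff_has_vector_derivative)
    then show ?thesis by (simp add: integral_unique)
  qed
  with d show ?thesis by (intro that) simp
qed

text \<open>The derivative as a combination of constant rank-one maps with the partial derivatives
  as coefficients: continuity and Lipschitz bounds in the operator norm reduce to those of scalar
  functions.\<close>

definition jacobian_blinfun :: "(real^'n::finite \<Rightarrow> real^'n) \<Rightarrow> real^'n \<Rightarrow> (real^'n) \<Rightarrow>\<^sub>L (real^'n)" where
  "jacobian_blinfun F x = (\<Sum>i\<in>UNIV. \<Sum>j\<in>UNIV. partial_deriv j (\<lambda>x. F x $ i) x *\<^sub>R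
     (blinfun_scaleR_left (axis i 1) o\<^sub>L blinfun_inner_right (axis j 1)))"

lemma jacobian_blinfun_apply:
  "jacobian_blinfun F x v = (\<Sum>i\<in>UNIV. (grad (\<lambda>x. F x $ i) x \<bullet> v) *\<^sub>R axis i 1)"
  by (simp add: jacobian_blinfun_def blinfun.sum_left blinfun.bilinear_simps grad_def
      inner_vec_def[of "vec_lambda _"] inner_axis' scaleR_sum_left)

lemma has_derivative_of_components:
  fixes F :: "real^'n::finite \<Rightarrow> real^'m::finite"
  assumes "\<And>i. (\<lambda>x. F x $ i) differentiable (at x)"
  shows "(F has_derivative (\<lambda>v. \<Sum>i\<in>UNIV. (grad (\<lambda>x. F x $ i) x \<bullet> v) *\<^sub>R axis i 1)) (at x)"
proof -
  have F_eq: "F x = (\<Sum>i\<in>UNIV. F x $ i *\<^sub>R axis i 1)" for x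
    using basis_expansion[of "F x"] by (simp add: scalar_mult_eq_scaleR)
  have "((\<lambda>x. \<Sum>i\<in>UNIV. F x $ i *\<^sub>R axis i 1) has_derivative
      (\<lambda>v. \<Sum>i\<in>UNIV. (grad (\<lambda>x. F x $ i) x \<bullet> v) *\<^sub>R axis i 1)) (at x)"
    by (intro has_derivative_sum has_derivative_scaleR_left has_derivative_grad assms)
  then show ?thesis
    by (rule has_derivative_transform[OF UNIV_I F_eq])
qed

lemma jacobian_row:
  fixes F :: "real^'n::finite \<Rightarrow> real^'m::finite"
  assumes "\<And>i. (\<lambda>x. F x $ i) differentiable (at x)"
  shows "jacobian F x $ i = grad (\<lambda>x. F x $ i) x"
proof -
  have "jacobian F x = matrix (\<lambda>v. \<Sum>i\<in>UNIV. (grad (\<lambda>x. F x $ i) x \<bullet> v) *\<^sub>R axis i 1)"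
    unfolding jacobian_def
    using frechet_derivative_at[OF has_derivative_of_components[OF assms]] by simp
  then show ?thesis
    by (simp add: vec_eq_iff matrix_def inner_axis) (simp add: axis_def if_distrib cong: if_cong)
qed

section \<open>Local Lipschitz bounds for derivatives of C^2 fields\<close>

lemma lipschitz_on_sum_finite:
  fixes f :: "'i \<Rightarrow> 'a::metric_space \<Rightarrow> 'b::real_normed_vector"
  assumes "\<And>i. i \<in> I \<Longrightarrow> \<exists>L. L-lipschitz_on S (f i)"
  shows "\<exists>L. L-lipschitz_on S (\<lambda>x. \<Sum>i\<in>I. f i x)"
  using assms
proof (induction I rule: infinite_finite_induct)
  case (insert i I)
  then obtain L M where "L-lipschitz_on S (f i)" "M-lipschitz_on S (\<lambda>x. \<Sum>i\<in>I. f i x)"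
    by (metis insertI1 insertI2)
  with insert show ?case
    by (auto intro: lipschitz_on_add)
qed (auto intro: lipschitz_on_constant)

lemma lipschitz_on_scaleR_const:
  fixes f :: "'a::metric_space \<Rightarrow> real" and v :: "'b::real_normed_vector"
  assumes "L-lipschitz_on S f"
  shows "(L * norm v)-lipschitz_on S (\<lambda>x. f x *\<^sub>R v)"
proof (rule lipschitz_onI)
  show "dist (f x *\<^sub>R v) (f y *\<^sub>R v) \<le> L * norm v * dist x y" if "x \<in> S" "y \<in> S" for x y
    using mult_right_mono[OF lipschitz_onD[OF assms that], of "norm v"]
    by (simp add: dist_norm mult_ac flip: scaleR_diff_left)
qed (use lipschitz_on_nonneg[OF assms] in simp)

lemma jacobian_blinfun_lipschitz:
  assumes "\<And>i. Ck 2 (\<lambda>x. F x $ i)"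
  shows "\<exists>L. L-lipschitz_on (cball 0 R) (jacobian_blinfun F)"
  unfolding jacobian_blinfun_def
proof (intro lipschitz_on_sum_finite)
  fix i j
  have "Ck 1 (partial_deriv j (\<lambda>x. F x $ i))"
    using assms[of i] by (simp add: numeral_2_eq_2)
  then obtain L where "L-lipschitz_on (cball 0 R) (partial_deriv j (\<lambda>x. F x $ i))"
    using Ck_1_lipschitz_on_cball by blast
  from lipschitz_on_scaleR_const[OF this]
  show "\<exists>L. L-lipschitz_on (cball 0 R) (\<lambda>x. partial_deriv j (\<lambda>x. F x $ i) x *\<^sub>R
       (blinfun_scaleR_left (axis i 1) o\<^sub>L blinfun_inner_right (axis j 1)))"
    by blast
qed

lemma has_derivative_jacobian_blinfun:
  assumes "\<And>i. Ck 1 (\<lambda>x. F x $ i)"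
  shows "(F has_derivative blinfun_apply (jacobian_blinfun F x)) (at x)"
  unfolding jacobian_blinfun_apply[abs_def]
  by (rule has_derivative_of_components) (use assms in simp)

lemma continuous_jacobian_blinfun:
  assumes "\<And>i. Ck 1 (\<lambda>x. F x $ i)"
  shows "continuous_on UNIV (jacobian_blinfun F)"
  unfolding jacobian_blinfun_def[abs_def]
  using assms by (intro continuous_intros) simp

text \<open>Equality of the cross derivatives is symmetry of the bilinear form given by the
  derivative of \<open>F\<close>.\<close>

lemma potential_of_closed_form:
  fixes F :: "real^'n::finite \<Rightarrow> real^'n"
  assumes F: "\<And>i. Ck 1 (\<lambda>x. F x $ i)"
    and closed: "\<And>i j x. partial_deriv j (\<lambda>x. F x $ i) x = partial_deriv i (\<lambda>x. F x $ j) x"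
  obtains \<phi> where "\<And>x. (\<phi> has_derivative (\<lambda>v. F x \<bullet> v)) (at x)"
proof (rule potential_of_symmetric_derivative)
  show "jacobian_blinfun F x v \<bullet> w = jacobian_blinfun F x w \<bullet> v" for x v w
  proof -
    have *: "jacobian_blinfun F x v \<bullet> w = (\<Sum>i\<in>UNIV. \<Sum>j\<in>UNIV. partial_deriv j (\<lambda>x. F x $ i) x * v $ j * w $ i)" for v w
      by (simp add: jacobian_blinfun_apply inner_sum_left inner_axis' grad_def inner_vec_def[of "vec_lambda _"] sum_distrib_right)
    show ?thesis
      unfolding * by (subst sum.swap) (simp add: closed mult_ac)
  qed
qed (use has_derivative_jacobian_blinfun[OF F] continuous_jacobian_blinfun[OF F] in auto)

text \<open>The field \<open>Y\<close> is grad u divided by its squared length \<open>d\<close>, so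
  that \<open>u\<close> has derivative 1 along it. The bound \<open>1 / c\<close> comes from |Y| = 1
  / |grad u|.\<close>

theorem gradient_transport_solvable:
  fixes u h :: "real^'n::finite \<Rightarrow> real"
  assumes u: "Ck 3 u" and "0 < c" and c: "\<And>x. c \<le> norm (grad u x)" and h: "Ck 1 h"
  obtains w where "Ck 1 w" "\<And>x. grad w x \<bullet> grad u x = h x"
proof -
  define d where "d x = grad u x \<bullet> grad u x" for x
  have d_pos: "0 < d x" for x
    using c[of x] \<open>0 < c\<close> by (auto simp: d_def)
  have pd: "Ck 2 (partial_deriv i u)" for i
    using u by (simp add: numeral_3_eq_3 numeral_2_eq_2)
  have "d = (\<lambda>x. \<Sum>i\<in>UNIV. partial_deriv i u x * partial_deriv i u x)"
    by (simp add: d_def fun_eq_iff inner_vec_def grad_def)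
  then have "Ck 2 (\<lambda>x. inverse (d x))"
    using d_pos pd by (intro Ck_inverse) (auto intro!: Ck_sum Ck_mult simp: less_le)
  note d_Ck = this this[unfolded numeral_2_eq_2, THEN Ck_SucD]
  define Y where "Y x = inverse (d x) *\<^sub>R grad u x" for x
  have Y_Ck: "Ck 2 (\<lambda>x. Y x $ i)" for i
    using Ck_mult[OF d_Ck(1) pd] by (simp add: Y_def grad_def)
  then have Y_Ck1: "Ck 1 (\<lambda>x. Y x $ i)" for i
    using Ck_SucD[of 1 "\<lambda>x. Y x $ i"] by (simp add: numeral_2_eq_2)
  have u1: "Ck 1 u"
    using Ck_SucD[OF Ck_SucD, of 1 u] u by (simp add: numeral_3_eq_3)
  interpret bounded_field Y "jacobian_blinfun Y" "1 / c"
  proof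
    show "(Y has_derivative blinfun_apply (jacobian_blinfun Y x)) (at x)" for x
      by (rule has_derivative_jacobian_blinfun[OF Y_Ck1])
    show "norm (Y x) \<le> 1 / c" for x
    proof -
      have "norm (Y x) = 1 / norm (grad u x)"
        using d_pos[of x] by (simp add: Y_def d_def dot_square_norm power2_eq_square field_simps)
      also have "\<dots> \<le> 1 / c"
        using c[of x] \<open>0 < c\<close> by (intro frac_le) auto
      finally show ?thesis .
    qed
    show "\<exists>L. L-lipschitz_on (cball 0 R) (jacobian_blinfun Y)" for R
      by (rule jacobian_blinfun_lipschitz[OF Y_Ck])
  qed
  have C1: "(f has_derivative blinfun_apply (blinfun_inner_right (grad f x))) (at x)"
    "continuous_on UNIV (\<lambda>x. blinfun_inner_right (grad f x))" if "Ck 1 f" for f :: "real^'n \<Rightarrow> real" and x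
    using that[unfolded Ck_1_iff_grad] has_derivative_grad[of f x]
    by (auto simp: blinfun_inner_right.rep_eq intro!: continuous_intros)
  \<comment> \<open>Dividing the desired equation by \<open>d\<close> makes it prescribe the
    derivative of \<open>w\<close> along \<open>Y\<close>.\<close>
  have hd: "Ck 1 (\<lambda>x. h x * inverse (d x))"
    using Ck_mult[OF h] d_Ck(2) by simp
  have uY: "blinfun_inner_right (grad u x) (Y x) = 1" for x
    using d_pos[of x] by (simp add: Y_def d_def)
  obtain w w' where w: "\<And>x. (w has_derivative blinfun_apply (w' x)) (at x)" "continuous_on UNIV w'"
    and eq: "\<And>x. w' x (Y x) = h x * inverse (d x)"
    using transport_solvable[OF C1[OF u1] uY C1[OF hd]] by blast
  show ?thesis
  proof
    show w1: "Ck 1 w" by (rule Ck_1I[OF w])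
    show "grad w x \<bullet> grad u x = h x" for x
    proof -
      have "blinfun_apply (w' x) = blinfun_apply (blinfun_inner_right (grad w x))"
        by (rule has_derivative_unique[OF w(1) C1(1)[OF w1]])
      then show ?thesis
        using eq[of x] d_pos[of x] by (simp add: Y_def)
    qed
  qed
qed

section \<open>The integrating factor and the map \<Phi>\<close>

lemma Ck_1_exp:
  fixes f :: "real^'n::finite \<Rightarrow> real"
  assumes "Ck 1 f"
  shows "Ck 1 (\<lambda>x. exp (f x))" "grad (\<lambda>x. exp (f x)) x = exp (f x) *\<^sub>R grad f x"
proof -
  have *: "((\<lambda>x. exp (f x)) has_derivative (\<lambda>v. (exp (f x) *\<^sub>R grad f x) \<bullet> v)) (at x)" for x
    using assms by (auto intro!: derivative_eq_intros has_derivative_grad)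
  show "grad (\<lambda>x. exp (f x)) x = exp (f x) *\<^sub>R grad f x" for x
    by (rule grad_eqI[OF *])
  then have "grad (\<lambda>x. exp (f x)) = (\<lambda>x. exp (f x) *\<^sub>R grad f x)"
    by (simp add: fun_eq_iff)
  then show "Ck 1 (\<lambda>x. exp (f x))"
    using assms Ck_imp_continuous[OF assms] * unfolding Ck_1_iff_grad
    by (auto simp: differentiable_def intro!: continuous_intros)
qed

theorem theoremA1:
  fixes u :: "real^2 \<Rightarrow> real"
  assumes "Ck 3 u"
    and "(INF x. norm (grad u x)) > 0"
  shows "\<exists>\<Phi> :: real^2 \<Rightarrow> real^2.
           (\<forall>i. Ck 1 (\<lambda>x. \<Phi> x $ i)) \<and>
           (\<forall>x. invertible (jacobian \<Phi> x)) \<and>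
           (\<forall>x. jacobian \<Phi> x *v grad u x = axis 1 1)"
proof -
  define c where "c = (INF x. norm (grad u x))"
  \<comment> \<open>A real infimum is a lower bound once the family is bounded below; for norms 0
    does it.\<close>
  have c: "c \<le> norm (grad u x)" for x
    unfolding c_def by (rule cINF_lower) (auto intro!: bdd_belowI[of _ 0])
  have "0 < c" using assms(2) by (simp add: c_def)
  note transport = gradient_transport_solvable[OF assms(1) \<open>0 < c\<close> c]
  have pd: "Ck 1 (partial_deriv i u)" "Ck 1 (partial_deriv i (partial_deriv j u))" for i j
    using assms(1) Ck_SucD[of 1 "partial_deriv i u"] by (simp_all add: numeral_3_eq_3)
  obtain \<Phi>1 where \<Phi>1: "Ck 1 \<Phi>1" and \<Phi>1_eq: "\<And>x. grad \<Phi>1 x \<bullet> grad u x = 1"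
    using transport[OF Ck_const[of 1 1]] by blast
  define \<Delta> where "\<Delta> x = partial_deriv 1 (partial_deriv 1 u) x + partial_deriv 2 (partial_deriv 2 u) x" for x
  have "Ck 1 (\<lambda>x. - \<Delta> x)"
    unfolding \<Delta>_def by (intro Ck_uminus Ck_add pd)
  then obtain w where w: "Ck 1 w" and w_eq: "\<And>x. grad w x \<bullet> grad u x = - \<Delta> x"
    using transport by blast
  define m where "m x = exp (w x)" for x
  have m: "Ck 1 m" and m_grad: "partial_deriv i m x = m x * partial_deriv i w x" for i x
    using Ck_1_exp[OF w] unfolding m_def[abs_def] grad_def by (simp_all add: vec_eq_iff)
  define F :: "real^2 \<Rightarrow> real^2" where
    "F x = vector [- (m x * partial_deriv 2 u x), m x * partial_deriv 1 u x]" for x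
  have F12: "F x $ 1 = - (m x * partial_deriv 2 u x)" "F x $ 2 = m x * partial_deriv 1 u x" for x
    by (simp_all add: F_def vector_2)
  have F_Ck: "Ck 1 (\<lambda>x. F x $ i)" for i
    using exhaust_2[of i] by (auto simp only: F12 intro!: Ck_uminus Ck_mult m pd)
  \<comment> \<open>This is div (m grad u) = 0. Each first derivative of \<open>u\<close> is
    differentiated in its own direction, so only the pure second derivatives collected in
    \<open>\<Delta>\<close> occur.\<close>
  have div_free: "partial_deriv 2 (\<lambda>x. F x $ 1) x = partial_deriv 1 (\<lambda>x. F x $ 2) x" for x
  proof -
    have diff: "m differentiable (at x)" "partial_deriv i u differentiable (at x)" for i
      using m pd(1) by simp_all
    have "partial_deriv 1 w x * partial_deriv 1 u x + partial_deriv 2 w x * partial_deriv 2 u x = - \<Delta> x"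
      using w_eq[of x] by (simp add: inner_vec_def sum_2 grad_def)
    then have "m x * (partial_deriv 1 w x * partial_deriv 1 u x + partial_deriv 2 w x * partial_deriv 2 u x + \<Delta> x) = 0"
      by simp
    then show ?thesis
      unfolding F12
      by (subst partial_deriv_uminus) (auto simp: partial_deriv_mult diff m_grad \<Delta>_def algebra_simps
          intro!: differentiable_mult)
  qed
  \<comment> \<open>In dimension two the pair of indices 1 and 2 is the only nontrivial
    case.\<close>
  have closed: "partial_deriv j (\<lambda>x. F x $ i) x = partial_deriv i (\<lambda>x. F x $ j) x" for i j x
    using exhaust_2[of i] exhaust_2[of j] div_free by auto
  obtain \<Phi>2 where \<Phi>2: "\<And>x. (\<Phi>2 has_derivative (\<lambda>v. F x \<bullet> v)) (at x)"
    using potential_of_closed_form[OF F_Ck closed] by blast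
  have \<Phi>2_grad: "grad \<Phi>2 x = F x" for x
    by (rule grad_eqI[OF \<Phi>2])
  have "continuous_on UNIV (\<lambda>x. \<chi> i. F x $ i)"
    by (intro continuous_on_vec_lambda Ck_imp_continuous[OF F_Ck])
  then have \<Phi>2_Ck: "Ck 1 \<Phi>2"
    unfolding Ck_1_iff_grad \<Phi>2_grad[abs_def] using \<Phi>2 by (auto simp: differentiable_def vec_lambda_eta)
  define \<Phi> :: "real^2 \<Rightarrow> real^2" where "\<Phi> x = vector [\<Phi>1 x, \<Phi>2 x]" for x
  have \<Phi>12: "\<Phi> x $ 1 = \<Phi>1 x" "\<Phi> x $ 2 = \<Phi>2 x" for x
    by (simp_all add: \<Phi>_def vector_2)
  have \<Phi>_Ck: "Ck 1 (\<lambda>x. \<Phi> x $ i)" for i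
    using exhaust_2[of i] \<Phi>1 \<Phi>2_Ck by (auto simp only: \<Phi>12)
  have rows: "jacobian \<Phi> x $ 1 = grad \<Phi>1 x" "jacobian \<Phi> x $ 2 = F x" for x
    using jacobian_row[of \<Phi> x] \<Phi>_Ck by (simp_all add: \<Phi>12 \<Phi>2_grad)
  have inner_1: "grad \<Phi>1 x $ 1 * partial_deriv 1 u x + grad \<Phi>1 x $ 2 * partial_deriv 2 u x = 1" for x
    using \<Phi>1_eq[of x] by (simp add: inner_vec_def sum_2 grad_def)
  have "det (jacobian \<Phi> x) = m x" for x
  proof -
    have "det (jacobian \<Phi> x) = m x * (grad \<Phi>1 x $ 1 * partial_deriv 1 u x + grad \<Phi>1 x $ 2 * partial_deriv 2 u x)"
      by (simp add: det_2 rows F12 algebra_simps)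
    then show ?thesis by (simp add: inner_1)
  qed
  then have "invertible (jacobian \<Phi> x)" for x
    by (simp add: invertible_det_nz m_def)
  moreover have "jacobian \<Phi> x *v grad u x = axis 1 1" for x
    using inner_1[of x]
    by (simp add: vec_eq_iff forall_2 matrix_vector_mult_def sum_2 rows F12 grad_def[of u] axis_def)
  ultimately show ?thesis using \<Phi>_Ck by blast
qed

end
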